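(* Let $R$ be a standard graded polynomial ring over a field $k$ with graded maximal ideal $\mathfrak m$. Let $x$ be a non-zero linear form, and let $I'$ and $T$ be non-zero homogeneous ideals of $R$ such that the following conditions hold simultaneously: (i) $I'$ is Koszul; (ii) $T\subseteq \mathfrak m I'$; (iii) $x$ is a regular element with respect to $R/T$ and with respect to $\operatorname{gr}_{\mathfrak m}T$. Denote $I=xI'+T$. Then $I$ is Koszul if and only if $T$ is Koszul.
   Context: Let $M$ be a finitely generated graded $R$-module with minimal graded free resolution $F$. For $i\ge 0$ let $\mathcal F^iF$ be the subcomplex $\cdots\to F_{i+1}\to F_i\to \mathfrak mF_{i-1}\to\cdots\to\mathfrak m^iF_0\to 0$ of $F$, and let $\operatorname{lin}^RF=\bigoplus_{i\ge0}\mathcal F^iF/\mathcal F^{i+1}F$. The linearity defect is $\operatorname{ld}_RM=\sup\{i : H_i(\operatorname{lin}^RF)\ne0\}$, and $M$ is called Koszul if $\operatorname{ld}_RM=0$. Over a polynomial ring $R$, $M$ is Koszul if and only if $M$ is componentwise linear, i.e. for every $d\in\mathbb Z$ the submodule $M_{\langle d\rangle}$ generated by the homogeneous elements of degree $d$ of $M$ has a $d$-linear resolution. An ideal is called Koszul if it is Koszul as an $R$-module. $\operatorname{gr}_{\mathfrak m}T=\bigoplus_{s\ge0}\mathfrak m^sT/\mathfrak m^{s+1}T$ is the associated graded module of $T$ with respect to the $\mathfrak m$-adic filtration; it is a module over $\operatorname{gr}_{\mathfrak m}R\cong R$. That $x$ is regular with respect to $\operatorname{gr}_{\mathfrak m}T$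 means that multiplication by $x$, $\mathfrak m^sT/\mathfrak m^{s+1}T\to\mathfrak m^{s+1}T/\mathfrak m^{s+2}T$, is injective for all $s\ge0$. *)

theory Defs
  imports
    "HOL-Library.Poly_Mapping"
    "HOL-Library.Function_Algebras"
    "HOL-Library.Set_Algebras"
    "HOL-Library.Extended_Nat"
begin

section \<open>The standard graded polynomial ring\<close>

text \<open>The polynomial ring over \<open>'k\<close> in finitely many variables indexed by \<open>'x\<close>:
  finitely supported maps from exponent vectors to coefficients.\<close>

type_synonym ('x, 'k) mpoly = "('x \<Rightarrow>\<^sub>0 nat) \<Rightarrow>\<^sub>0 'k"

definition mono_degree :: "('x::finite \<Rightarrow>\<^sub>0 nat) \<Rightarrow> nat" where
  "mono_degree m = (\<Sum>i\<in>UNIV. Poly_Mapping.lookup m i)"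

text \<open>The zero polynomial is homogeneous of every degree, and it is the only polynomial
  that is homogeneous of a negative degree.\<close>

definition homogeneous :: "int \<Rightarrow> ('x::finite, 'k::field) mpoly \<Rightarrow> bool" where
  "homogeneous d f \<longleftrightarrow> (\<forall>m\<in>Poly_Mapping.keys f. int (mono_degree m) = d)"

definition Var :: "'x \<Rightarrow> ('x::finite, 'k::field) mpoly" where
  "Var i = Poly_Mapping.single (Poly_Mapping.single i 1) 1"

abbreviation ideal_gen :: "('x::finite, 'k::field) mpoly set \<Rightarrow> ('x, 'k) mpoly set" where
  "ideal_gen \<equiv> module.span (*)"

definition homogeneous_ideal :: "('x::finite, 'k::field) mpoly set \<Rightarrow> bool" where
  "homogeneous_ideal J \<longleftrightarrow> (\<exists>G. (\<forall>g\<in>G. \<exists>d. homogeneous d g) \<and> J = ideal_gen G)"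

definition max_ideal :: "('x::finite, 'k::field) mpoly set" where
  "max_ideal = ideal_gen (range Var)"

text \<open>The submodule \<open>J N\<close> of a module with scalar multiplication \<open>scale\<close>, for an ideal \<open>J\<close>
  and a submodule \<open>N\<close>; with \<open>scale = (*)\<close> this is the product of ideals.\<close>

definition ideal_smult ::
  "('r::comm_ring_1 \<Rightarrow> 'v::ab_group_add \<Rightarrow> 'v) \<Rightarrow> 'r set \<Rightarrow> 'v set \<Rightarrow> 'v set" where
  "ideal_smult scale J N = module.span scale {scale a v |a v. a \<in> J \<and> v \<in> N}"

definition max_ideal_power :: "nat \<Rightarrow> ('x::finite, 'k::field) mpoly set" where
  "max_ideal_power s = (ideal_smult (*) max_ideal ^^ s) UNIV"

section \<open>Quotients, and maps induced on them\<close>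

text \<open>The quotient \<open>A / N\<close> as the set of cosets \<open>v + N\<close> with \<open>v \<in> A\<close>.  A map \<open>f\<close> that
  sends \<open>N\<close> into \<open>N'\<close> induces the map \<open>v + N \<mapsto> f v + N'\<close>; on the coset \<open>C\<close> its value is
  \<open>f ` C + N'\<close> (sum of sets).\<close>

definition quotient_module :: "'v::ab_group_add set \<Rightarrow> 'v set \<Rightarrow> 'v set set" where
  "quotient_module A N = (\<lambda>v. v +o N) ` A"

definition induced_map ::
  "('v \<Rightarrow> 'w::ab_group_add) \<Rightarrow> 'w set \<Rightarrow> 'v set \<Rightarrow> 'w set" where
  "induced_map f N' C = f ` C + N'"

definition regular_on_quotient ::
  "('x::finite, 'k::field) mpoly \<Rightarrow> ('x, 'k) mpoly set \<Rightarrow> bool" where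
  "regular_on_quotient x T \<longleftrightarrow> inj_on (induced_map ((*) x) T) (quotient_module UNIV T)"

text \<open>Regularity of a linear form on the associated graded module of the ideal \<open>T\<close>.\<close>

definition regular_on_gr ::
  "('x::finite, 'k::field) mpoly \<Rightarrow> ('x, 'k) mpoly set \<Rightarrow> bool" where
  "regular_on_gr x T \<longleftrightarrow>
     (\<forall>s. inj_on (induced_map ((*) x) (ideal_smult (*) (max_ideal_power (s + 2)) T))
            (quotient_module (ideal_smult (*) (max_ideal_power s) T)
                             (ideal_smult (*) (max_ideal_power (s + 1)) T)))"

section \<open>Minimal graded free resolutions of ideals\<close>

text \<open>A complex of free modules of finite rank with chosen bases and an augmentation into the
  ring.  The module \<open>F\<^sub>i\<close> has basis elements \<open>e\<^sub>j\<close> of degree \<open>shift F i j\<close>, for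
  \<open>j < rank F i\<close>.  For \<open>i > 0\<close> the differential \<open>F\<^sub>i \<rightarrow> F\<^sub>i\<^sub>-\<^sub>1\<close> has the matrix entry
  \<open>entry F i l j\<close> in row \<open>l\<close> and column \<open>j\<close>; the augmentation sends \<open>e\<^sub>j \<in> F\<^sub>0\<close> to \<open>gen F j\<close>.
  Values of these functions at indices out of range are irrelevant.\<close>

record (overloaded) ('x, 'k) free_complex =
  rank :: "nat \<Rightarrow> nat"
  shift :: "nat \<Rightarrow> nat \<Rightarrow> int"
  entry :: "nat \<Rightarrow> nat \<Rightarrow> nat \<Rightarrow> ('x, 'k) mpoly"
  gen :: "nat \<Rightarrow> ('x, 'k) mpoly"

type_synonym ('x, 'k) vec = "nat \<Rightarrow> ('x, 'k) mpoly"

definition free_scale ::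
  "('x::finite, 'k::field) mpoly \<Rightarrow> ('x, 'k) vec \<Rightarrow> ('x, 'k) vec" where
  "free_scale r v = (\<lambda>j. r * v j)"

definition chain_module ::
  "('x::finite, 'k::field) free_complex \<Rightarrow> nat \<Rightarrow> ('x, 'k) vec set" where
  "chain_module F i = {v. \<forall>j\<ge>rank F i. v j = 0}"

definition differential ::
  "('x::finite, 'k::field) free_complex \<Rightarrow> nat \<Rightarrow> ('x, 'k) vec \<Rightarrow> ('x, 'k) vec" where
  "differential F i v =
     (if i = 0 then 0
      else (\<lambda>l. if l < rank F (i - 1) then \<Sum>j<rank F i. v j * entry F i l j else 0))"

definition augmentation ::
  "('x::finite, 'k::field) free_complex \<Rightarrow> ('x, 'k) vec \<Rightarrow> ('x, 'k) mpoly" where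
  "augmentation F v = (\<Sum>j<rank F 0. v j * gen F j)"

definition minimal_graded_free_resolution ::
  "('x::finite, 'k::field) free_complex \<Rightarrow> ('x, 'k) mpoly set \<Rightarrow> bool" where
  "minimal_graded_free_resolution F M \<longleftrightarrow>
     (\<forall>j<rank F 0. homogeneous (shift F 0 j) (gen F j)) \<and>
     (\<forall>i. \<forall>l<rank F i. \<forall>j<rank F (Suc i).
        homogeneous (shift F (Suc i) j - shift F i l) (entry F (Suc i) l j)) \<and>
     augmentation F ` chain_module F 0 = M \<and>
     differential F 1 ` chain_module F 1 = {v \<in> chain_module F 0. augmentation F v = 0} \<and>
     (\<forall>i. differential F (Suc (Suc i)) ` chain_module F (Suc (Suc i)) =
        {v \<in> chain_module F (Suc i). differential F (Suc i) v = 0}) \<and>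
     (\<forall>i. differential F (Suc i) ` chain_module F (Suc i) \<subseteq>
        ideal_smult free_scale max_ideal (chain_module F i))"

section \<open>The linear part and the linearity defect\<close>

text \<open>The module in homological degree \<open>i\<close> of the \<open>p\<close>-th subcomplex of the filtration:
  \<open>\<mm>\<^bsup>p-i\<^esup> F\<^sub>i\<close> for \<open>i \<le> p\<close>, and \<open>F\<^sub>i\<close> for \<open>i > p\<close>
  (truncated subtraction).\<close>

definition lin_filtration ::
  "('x::finite, 'k::field) free_complex \<Rightarrow> nat \<Rightarrow> nat \<Rightarrow> ('x, 'k) vec set" where
  "lin_filtration F p i = ideal_smult free_scale (max_ideal_power (p - i)) (chain_module F i)"

text \<open>The linear part is a direct sum over \<open>p\<close> of quotient complexes; its elements in
  homological degree \<open>i\<close> are the finitely supported families \<open>c\<close> of cosets, \<open>c p\<close> being an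
  element of the \<open>p\<close>-th quotient.\<close>

definition lin_zero ::
  "('x::finite, 'k::field) free_complex \<Rightarrow> nat \<Rightarrow> nat \<Rightarrow> ('x, 'k) vec set" where
  "lin_zero F i = (\<lambda>p. lin_filtration F (Suc p) i)"

definition lin_module ::
  "('x::finite, 'k::field) free_complex \<Rightarrow> nat \<Rightarrow> (nat \<Rightarrow> ('x, 'k) vec set) set" where
  "lin_module F i =
     {c. (\<forall>p. c p \<in> quotient_module (lin_filtration F p i) (lin_filtration F (Suc p) i)) \<and>
         finite {p. c p \<noteq> lin_zero F i p}}"

text \<open>In homological degree \<open>0\<close> the differential is zero; there \<open>i - 1 = 0\<close>, which is
  harmless: the zero map into \<open>F\<^sub>0\<close> has the same kernel as the map to the zero module.\<close>

definition lin_differential ::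
  "('x::finite, 'k::field) free_complex \<Rightarrow> nat
    \<Rightarrow> (nat \<Rightarrow> ('x, 'k) vec set) \<Rightarrow> (nat \<Rightarrow> ('x, 'k) vec set)" where
  "lin_differential F i c =
     (\<lambda>p. induced_map (differential F i) (lin_filtration F (Suc p) (i - 1)) (c p))"

definition lin_homology_nonzero :: "('x::finite, 'k::field) free_complex \<Rightarrow> nat \<Rightarrow> bool" where
  "lin_homology_nonzero F i \<longleftrightarrow>
     {c \<in> lin_module F i. lin_differential F i c = lin_zero F (i - 1)} \<noteq>
     lin_differential F (Suc i) ` lin_module F (Suc i)"

text \<open>A minimal graded free resolution of a homogeneous ideal exists and is unique up to
  isomorphism of graded complexes, so the choice is immaterial.  The supremum of the empty set
  is \<open>0\<close> in \<open>enat\<close>, which matters only for the zero module.\<close>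

definition linearity_defect :: "('x::finite, 'k::field) mpoly set \<Rightarrow> enat" where
  "linearity_defect M =
     (let F = (SOME F. minimal_graded_free_resolution F M)
      in SUP i\<in>{i. lin_homology_nonzero F i}. enat i)"

definition Koszul :: "('x::finite, 'k::field) mpoly set \<Rightarrow> bool" where
  "Koszul M \<longleftrightarrow> linearity_defect M = 0"

end

theory Submission
  imports Defs
begin

text \<open>
  Let \<open>F\<close> and \<open>G\<close> be minimal free resolutions of \<open>T\<close> and \<open>I'\<close>.  As \<open>x\<close> is regular on
  \<open>R / T\<close> and \<open>T \<subseteq> I'\<close>, the ideals \<open>x I'\<close> and \<open>T\<close> meet in \<open>x T\<close>, which gives
  an exact sequence \<open>0 \<rightarrow> T \<rightarrow> I' \<oplus> T \<rightarrow> I \<rightarrow> 0\<close> with \<open>t \<mapsto> (t, - x t)\<close>.  Hence \<open>I\<close> is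
  resolved by the mapping cone of \<open>(\<phi>, - x) : F \<rightarrow> G \<oplus> F\<close>, where \<open>\<phi>\<close> lifts the
  inclusion.  Since \<open>I'\<close> is Koszul and \<open>T \<subseteq> \<mm> I'\<close>, the lift \<open>\<phi>\<close> takes values in \<open>\<mm> G\<close>
  (lemma \<open>minimal_chain_map_exists\<close>), so the cone is a minimal resolution, and its linear part is
  the cone of the linear parts.

  The homology of \<open>lin G\<close> vanishes in positive degrees, so there is a long exact sequence
  in which the positive homology of the linear part of the cone sits between homologies of
  \<open>lin F\<close>.  If \<open>T\<close> is Koszul, only \<open>H\<^sub>1\<close> of the cone could survive, and it
  embeds in the kernel of multiplication by \<open>x\<close> on \<open>H\<^sub>0 (lin F)\<close>, the associated graded
  module of \<open>T\<close>, on which \<open>x\<close> is regular.  Conversely, if \<open>I\<close> is Koszul, then \<open>x\<close> acts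
  surjectively on \<open>H\<^sub>i (lin F)\<close> for \<open>i > 0\<close>, and as \<open>x\<close> raises degrees, these modules
  vanish.  These are the lemmas \<open>acyclic_imp_cone_acyclic\<close> and \<open>cone_acyclic_imp_acyclic\<close>.

  All of this is carried out on representatives in \<open>\<mm>\<^sup>s F\<close>.  The linearity defect is defined
  by a minimal graded free resolution, which exists by Hilbert's basis theorem and the minimal choice
  of homogeneous generators (\<open>minimal_graded_free_resolution_exists\<close>); by a chain homotopy argument
  (\<open>linear_part_acyclic_transfer\<close>) any other minimal free resolution may replace it.
\<close>

section \<open>Powers of the maximal ideal\<close>

lemma mono_degree_zero [simp]: "mono_degree 0 = 0"
  by (simp add: mono_degree_def)

lemma mono_degree_add: "mono_degree (m + n) = mono_degree m + mono_degree n"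
  by (simp add: mono_degree_def lookup_add sum.distrib)

lemma mono_degree_single [simp]: "mono_degree (Poly_Mapping.single i n) = n"
  by (simp add: mono_degree_def lookup_single when_def)

lemma mono_degree_eq_0_iff: "mono_degree m = 0 \<longleftrightarrow> m = 0"
  by (auto simp: mono_degree_def poly_mapping_eq_iff fun_eq_iff)

text \<open>The power \<open>\<mm>\<^sup>s\<close>, described by what one computes with: no monomial of
  degree below \<open>s\<close> occurs.\<close>

definition mpow :: "nat \<Rightarrow> ('x::finite, 'k::field) mpoly set" where
  "mpow s = {f. \<forall>m\<in>Poly_Mapping.keys f. s \<le> mono_degree m}"

lemma mpow_0 [simp]: "mpow 0 = UNIV"
  by (simp add: mpow_def)

lemma mpow_antimono: "f \<in> mpow t \<Longrightarrow> s \<le> t \<Longrightarrow> f \<in> mpow s"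
  by (auto simp: mpow_def)

lemma zero_in_mpow [simp]: "0 \<in> mpow s"
  by (simp add: mpow_def)

lemma add_in_mpow: "f \<in> mpow s \<Longrightarrow> g \<in> mpow s \<Longrightarrow> f + g \<in> mpow s"
  using keys_add[of f g] by (auto simp: mpow_def)

lemma mult_in_mpow: "f \<in> mpow s \<Longrightarrow> g \<in> mpow t \<Longrightarrow> f * g \<in> mpow (s + t)"
proof -
  assume a: "f \<in> mpow s" "g \<in> mpow t"
  have "s + t \<le> mono_degree m" if m: "m \<in> Poly_Mapping.keys (f * g)" for m
  proof -
    obtain k l where "m = k + l" "k \<in> Poly_Mapping.keys f" "l \<in> Poly_Mapping.keys g"
      using keys_mult[of f g] m by blast
    then show ?thesis
      using a by (simp add: mpow_def mono_degree_add add_mono)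
  qed
  then show ?thesis by (simp add: mpow_def)
qed

lemma mult_left_in_mpow: "g \<in> mpow t \<Longrightarrow> f * g \<in> mpow t"
  using mult_in_mpow[of f 0 g t] by simp

lemma homogeneous_1_in_mpow: "homogeneous 1 f \<Longrightarrow> f \<in> mpow 1"
  by (auto simp: homogeneous_def mpow_def)

lemma mpow_1_iff: "f \<in> mpow 1 \<longleftrightarrow> Poly_Mapping.lookup f 0 = 0"
proof -
  have "f \<in> mpow 1 \<longleftrightarrow> 0 \<notin> Poly_Mapping.keys f"
    by (force simp: mpow_def Suc_le_eq mono_degree_eq_0_iff zero_less_iff_neq_zero)
  then show ?thesis by (simp add: in_keys_iff)
qed

lemma poly_mapping_sum_single:
  "f = (\<Sum>m\<in>Poly_Mapping.keys f. Poly_Mapping.single m (Poly_Mapping.lookup f m))"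
  by (rule poly_mapping_eqI) (simp add: lookup_sum lookup_single when_def in_keys_iff)

interpretation ring_module: module "(*) :: 'r::comm_ring_1 \<Rightarrow> 'r \<Rightarrow> 'r"
  by unfold_locales (simp_all add: algebra_simps)

text \<open>As a simplification rule this instance of associativity loops with \<open>mult.assoc\<close>.\<close>
declare ring_module.scale_scale [simp del]

lemma subspace_mpow: "ring_module.subspace (mpow s)"
  by (simp add: ring_module.subspace_def add_in_mpow mult_left_in_mpow)

lemma Var_in_mpow: "Var i \<in> mpow 1"
  by (auto simp: Var_def mpow_def keys_single)

lemma max_ideal_subset: "max_ideal \<subseteq> mpow 1"
  unfolding max_ideal_def by (rule ring_module.span_minimal[OF _ subspace_mpow]) (auto simp: Var_in_mpow[simplified])

text \<open>Every monomial of positive degree is divisible by a variable.\<close>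

lemma max_ideal_mult_mpow:
  "ideal_smult (*) max_ideal (mpow s) = (mpow (Suc s) :: ('x::finite, 'k::field) mpoly set)" (is "?l = ?r")
proof
  show "?l \<subseteq> ?r"
    unfolding ideal_smult_def
    by (rule ring_module.span_minimal[OF _ subspace_mpow])
      (use max_ideal_subset mult_in_mpow[of _ 1 _ s] in \<open>auto simp: subset_eq\<close>)
  show "?r \<subseteq> ?l"
  proof
    fix f :: "('x, 'k) mpoly" assume f: "f \<in> mpow (Suc s)"
    have "Poly_Mapping.single m (Poly_Mapping.lookup f m) \<in> ideal_smult (*) max_ideal (mpow s)"
      if m: "m \<in> Poly_Mapping.keys f" for m
    proof -
      have deg: "Suc s \<le> mono_degree m"
        using f m by (auto simp: mpow_def)
      then have "mono_degree m \<noteq> 0" by simp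
      then obtain i where i: "Poly_Mapping.lookup m i \<noteq> 0"
        by (auto simp: mono_degree_def)
      define n where "n = m - Poly_Mapping.single i 1"
      have mn: "m = Poly_Mapping.single i 1 + n"
        using i by (intro poly_mapping_eqI)
          (auto simp: n_def lookup_add lookup_minus lookup_single when_def)
      have "Poly_Mapping.single n (Poly_Mapping.lookup f m) \<in> mpow s"
        using deg by (auto simp: mpow_def mn mono_degree_add)
      moreover have "Poly_Mapping.single m (Poly_Mapping.lookup f m) =
          Var i * Poly_Mapping.single n (Poly_Mapping.lookup f m)"
        by (simp add: Var_def mult_single mn[unfolded One_nat_def, symmetric])
      moreover have "Var i \<in> max_ideal"
        unfolding max_ideal_def by (rule ring_module.span_base) simp
      ultimately show ?thesis
        unfolding ideal_smult_def by (blast intro: ring_module.span_base)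
    qed
    then have "(\<Sum>m\<in>Poly_Mapping.keys f. Poly_Mapping.single m (Poly_Mapping.lookup f m))
        \<in> ideal_smult (*) max_ideal (mpow s)"
      unfolding ideal_smult_def by (rule ring_module.span_sum)
    then show "f \<in> ideal_smult (*) max_ideal (mpow s)"
      by (simp flip: poly_mapping_sum_single)
  qed
qed

lemma max_ideal_power_eq: "max_ideal_power s = mpow s"
proof (induction s)
  case (Suc s)
  then show ?case
    using max_ideal_mult_mpow[of s] by (simp add: max_ideal_power_def)
qed (simp add: max_ideal_power_def)

lemma max_ideal_eq: "max_ideal = (mpow 1 :: ('x::finite, 'k::field) mpoly set)"
proof -
  have "(mpow 1 :: ('x, 'k) mpoly set) = ideal_smult (*) max_ideal UNIV"
    using max_ideal_mult_mpow[where 'x = 'x and 'k = 'k, of 0] by simp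
  also have "\<dots> \<subseteq> max_ideal"
    unfolding ideal_smult_def
  proof (rule ring_module.span_minimal)
    show "{a * v |a v. a \<in> max_ideal \<and> v \<in> UNIV} \<subseteq> (max_ideal :: ('x, 'k) mpoly set)"
    proof safe
      fix a v :: "('x, 'k) mpoly" assume "a \<in> max_ideal"
      then show "a * v \<in> max_ideal"
        unfolding max_ideal_def using ring_module.span_scale[of a _ v] by (simp add: mult.commute)
    qed
  qed (simp add: max_ideal_def)
  finally show ?thesis using max_ideal_subset by blast
qed


section \<open>Free modules and linear maps\<close>

text \<open>The index type is arbitrary, because the modules of a mapping cone are indexed by a sum type.
  For vectors indexed by natural numbers this is \<open>free_scale\<close>.\<close>

definition smul :: "'r::comm_ring_1 \<Rightarrow> ('b \<Rightarrow> 'r) \<Rightarrow> 'b \<Rightarrow> 'r" where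
  "smul r v = (\<lambda>j. r * v j)"

lemma smul_apply [simp]: "smul r v j = r * v j"
  by (simp add: smul_def)

lemma free_scale_eq: "free_scale = smul"
  by (simp add: fun_eq_iff free_scale_def)

lemma sum_fun_apply: "(\<Sum>i\<in>A. f i) j = (\<Sum>i\<in>A. f i j)"
  by (induction A rule: infinite_finite_induct) auto

interpretation free_module: module "smul :: 'r::comm_ring_1 \<Rightarrow> ('b \<Rightarrow> 'r) \<Rightarrow> ('b \<Rightarrow> 'r)"
  by unfold_locales (simp_all add: smul_def fun_eq_iff distrib_left distrib_right mult.assoc)

text \<open>Maps are linear on the space of all vectors.  For \<open>differential\<close> and
  \<open>augmentation\<close> this holds since they ignore the coordinates out of range, and it spares
  every computation a membership condition.\<close>

abbreviation linear_map :: "(('b \<Rightarrow> 'r::comm_ring_1) \<Rightarrow> ('c \<Rightarrow> 'r)) \<Rightarrow> bool" where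
  "linear_map \<equiv> module_hom smul smul"

abbreviation linear_form :: "(('b \<Rightarrow> 'r::comm_ring_1) \<Rightarrow> 'r) \<Rightarrow> bool" where
  "linear_form \<equiv> module_hom smul (*)"

lemma linear_mapI:
  "(\<And>v w. h (v + w) = h v + h w) \<Longrightarrow> (\<And>r v. h (smul r v) = smul r (h v)) \<Longrightarrow> linear_map h"
  by unfold_locales

lemma linear_formI:
  "(\<And>v w. h (v + w) = h v + h w) \<Longrightarrow> (\<And>r v. h (smul r v) = r * h v) \<Longrightarrow> linear_form h"
  by unfold_locales

lemma linear_map_compose:
  assumes "linear_map f" "linear_map g"
  shows "linear_map (\<lambda>v. f (g v))"
  by (rule linear_mapI) (simp_all add: assms[THEN module_hom.add] assms[THEN module_hom.scale])

lemma linear_map_diff: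
  assumes "linear_map f" "linear_map g"
  shows "linear_map (\<lambda>v. f v - g v)"
  by (rule linear_mapI) (simp_all add: assms[THEN module_hom.add] assms[THEN module_hom.scale]
      free_module.scale_right_diff_distrib)

text \<open>The submodule \<open>\<mm>\<^sup>s F\<close> of the free module \<open>F\<close> on the index set \<open>J\<close>; in particular
  \<open>fpow J 0\<close> is \<open>F\<close> itself.\<close>

definition fpow :: "'b set \<Rightarrow> nat \<Rightarrow> ('b \<Rightarrow> ('x::finite, 'k::field) mpoly) set" where
  "fpow J s = {v. \<forall>j. v j \<in> mpow s \<and> (j \<notin> J \<longrightarrow> v j = 0)}"

lemma fpowI: "(\<And>j. j \<in> J \<Longrightarrow> v j \<in> mpow s) \<Longrightarrow> (\<And>j. j \<notin> J \<Longrightarrow> v j = 0) \<Longrightarrow> v \<in> fpow J s"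
  by (simp add: fpow_def) (metis zero_in_mpow)

lemma subspace_fpow: "free_module.subspace (fpow J s)"
  by (simp add: free_module.subspace_def fpow_def add_in_mpow mult_left_in_mpow)

lemmas zero_in_fpow [simp] = free_module.subspace_0[OF subspace_fpow]
  and add_in_fpow = free_module.subspace_add[OF subspace_fpow]
  and diff_in_fpow = free_module.subspace_diff[OF subspace_fpow]
  and neg_in_fpow = free_module.subspace_neg[OF subspace_fpow]
  and sum_in_fpow = free_module.subspace_sum[OF subspace_fpow]
  and smul_in_fpow = free_module.subspace_scale[OF subspace_fpow]

lemma fpow_antimono: "v \<in> fpow J t \<Longrightarrow> s \<le> t \<Longrightarrow> v \<in> fpow J s"
  by (auto simp: fpow_def intro: mpow_antimono)

lemma smul_in_fpow_add: "r \<in> mpow s \<Longrightarrow> v \<in> fpow J t \<Longrightarrow> smul r v \<in> fpow J (s + t)"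
  by (auto simp: fpow_def mult_in_mpow)

definition unit_vec :: "'b \<Rightarrow> 'b \<Rightarrow> 'r::comm_ring_1" where
  "unit_vec j = (\<lambda>i. if i = j then 1 else 0)"

lemma unit_vec_in_fpow: "j \<in> J \<Longrightarrow> unit_vec j \<in> fpow J 0"
  by (auto simp: fpow_def unit_vec_def)

lemma unit_vec_expansion:
  assumes "finite J" "v \<in> fpow J 0"
  shows "v = (\<Sum>j\<in>J. smul (v j) (unit_vec j))"
  using assms by (auto simp: fun_eq_iff sum_fun_apply fpow_def unit_vec_def if_distrib cong: if_cong)

lemma module_hom_expansion:
  assumes "module_hom smul scale h" "finite J" "v \<in> fpow J 0"
  shows "h v = (\<Sum>j\<in>J. scale (v j) (h (unit_vec j)))"
  by (subst unit_vec_expansion[OF assms(2,3)])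
    (simp add: module_hom.sum[OF assms(1)] module_hom.scale[OF assms(1)])

text \<open>A linear map that raises the \<open>\<mm>\<close>-adic order of basis vectors by \<open>t\<close> raises all orders by
  \<open>t\<close>.  Minimality of a differential is the case \<open>t = 1\<close>.\<close>

lemma linear_map_fpow:
  assumes "linear_map h" "finite J" "\<And>v. v \<in> fpow J 0 \<Longrightarrow> h v \<in> fpow K t" "v \<in> fpow J s"
  shows "h v \<in> fpow K (s + t)"
  unfolding module_hom_expansion[OF assms(1,2) fpow_antimono[OF assms(4) le0]]
  using assms(4) by (auto simp: fpow_def[of J] intro!: sum_in_fpow smul_in_fpow_add assms(3) unit_vec_in_fpow)

lemma ideal_smult_fpow:
  assumes "finite J"
  shows "ideal_smult smul (mpow s) (fpow J 0) = fpow J s"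
proof
  show "ideal_smult smul (mpow s) (fpow J 0) \<subseteq> fpow J s"
    unfolding ideal_smult_def
    by (rule free_module.span_minimal[OF _ subspace_fpow])
      (use smul_in_fpow_add[of _ s _ J 0] in auto)
  show "fpow J s \<subseteq> ideal_smult smul (mpow s) (fpow J 0)"
  proof
    fix v assume v: "v \<in> fpow J s"
    have "(\<Sum>j\<in>J. smul (v j) (unit_vec j)) \<in> ideal_smult smul (mpow s) (fpow J 0)"
      unfolding ideal_smult_def
      by (intro free_module.span_sum free_module.span_base)
        (use v in \<open>auto simp: fpow_def[of _ s] intro: unit_vec_in_fpow\<close>)
    then show "v \<in> ideal_smult smul (mpow s) (fpow J 0)"
      by (simp flip: unit_vec_expansion[OF assms fpow_antimono[OF v le0]])
  qed
qed

text \<open>A free module is projective: a map on it lifts along any map whose image contains its own.\<close>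

lemma lift_along:
  assumes \<theta>: "module_hom smul scale \<theta>" and D: "module_hom smul scale D" and fin: "finite J"
    and im: "\<And>v. v \<in> fpow J 0 \<Longrightarrow> \<theta> v \<in> D ` fpow K 0"
  obtains h where "linear_map h"
    and "\<And>v. v \<in> fpow J 0 \<Longrightarrow> h v \<in> fpow K 0"
    and "\<And>v. v \<in> fpow J 0 \<Longrightarrow> D (h v) = \<theta> v"
proof -
  have "\<forall>j\<in>J. \<exists>w. w \<in> fpow K 0 \<and> D w = \<theta> (unit_vec j)"
    using im[OF unit_vec_in_fpow] by (metis imageE)
  then obtain c where c: "\<And>j. j \<in> J \<Longrightarrow> c j \<in> fpow K 0" "\<And>j. j \<in> J \<Longrightarrow> D (c j) = \<theta> (unit_vec j)"
    by metis
  define h where "h v = (\<Sum>j\<in>J. smul (v j) (c j))" for v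
  show thesis
  proof
    show "linear_map h"
      by (rule linear_mapI) (auto simp: h_def fun_eq_iff sum_fun_apply sum_distrib_left
          sum.distrib distrib_right mult.assoc)
    show "h v \<in> fpow K 0" if "v \<in> fpow J 0" for v
      unfolding h_def by (intro sum_in_fpow smul_in_fpow c)
    show "D (h v) = \<theta> v" if "v \<in> fpow J 0" for v
      by (simp add: h_def module_hom.sum[OF D] module_hom.scale[OF D] c
          module_hom_expansion[OF \<theta> fin that])
  qed
qed

lemma linear_form_image_fpow:
  assumes "linear_form \<epsilon>" "finite J"
  shows "\<epsilon> ` fpow J s = ideal_smult (*) (mpow s) (\<epsilon> ` fpow J 0)"
proof -
  have "\<epsilon> ` fpow J s = \<epsilon> ` free_module.span {smul a v |a v. a \<in> mpow s \<and> v \<in> fpow J 0}"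
    by (simp add: ideal_smult_fpow[OF assms(2)] flip: ideal_smult_def)
  also have "\<dots> = ring_module.span (\<epsilon> ` {smul a v |a v. a \<in> mpow s \<and> v \<in> fpow J 0})"
    by (rule module_hom.span_image[OF assms(1), symmetric])
  also have "\<epsilon> ` {smul a v |a v. a \<in> mpow s \<and> v \<in> fpow J 0} =
      {a * t |a t. a \<in> mpow s \<and> t \<in> \<epsilon> ` fpow J 0}"
  proof (intro equalityI subsetI)
    fix y assume "y \<in> \<epsilon> ` {smul a v |a v. a \<in> mpow s \<and> v \<in> fpow J 0}"
    then obtain a v where "y = \<epsilon> (smul a v)" "a \<in> mpow s" "v \<in> fpow J 0" by blast
    then show "y \<in> {a * t |a t. a \<in> mpow s \<and> t \<in> \<epsilon> ` fpow J 0}"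
      using module_hom.scale[OF assms(1)] by blast
  next
    fix y assume "y \<in> {a * t |a t. a \<in> mpow s \<and> t \<in> \<epsilon> ` fpow J 0}"
    then obtain a v where "y = a * \<epsilon> v" "a \<in> mpow s" "v \<in> fpow J 0" by blast
    then have "y = \<epsilon> (smul a v)" "smul a v \<in> {smul a v |a v. a \<in> mpow s \<and> v \<in> fpow J 0}"
      using module_hom.scale[OF assms(1)] by auto
    then show "y \<in> \<epsilon> ` {smul a v |a v. a \<in> mpow s \<and> v \<in> fpow J 0}" by blast
  qed
  finally show ?thesis by (simp add: ideal_smult_def)
qed


section \<open>Comparison of minimal resolutions\<close>

text \<open>Of the minimality of a resolution the comparison of linear parts uses one thing, that the
  differentials take values in \<open>\<mm> F\<close>; the mapping cone below is minimal in this sense.  The map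
  \<open>d i\<close> goes from the module in degree \<open>i + 1\<close> to the one in degree \<open>i\<close>.\<close>

locale minimal_resolution =
  fixes J :: "nat \<Rightarrow> 'b set"
    and d :: "nat \<Rightarrow> ('b \<Rightarrow> ('x::finite, 'k::field) mpoly) \<Rightarrow> 'b \<Rightarrow> ('x, 'k) mpoly"
    and \<epsilon> :: "('b \<Rightarrow> ('x, 'k) mpoly) \<Rightarrow> ('x, 'k) mpoly"
    and M :: "('x, 'k) mpoly set"
  assumes finite_J [simp]: "finite (J i)"
    and linear_d: "linear_map (d i)"
    and linear_aug: "linear_form \<epsilon>"
    and d_minimal: "v \<in> fpow (J (Suc i)) 0 \<Longrightarrow> d i v \<in> fpow (J i) 1"
    and aug_image: "\<epsilon> ` fpow (J 0) 0 = M"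
    and exact_0: "d 0 ` fpow (J 1) 0 = {v \<in> fpow (J 0) 0. \<epsilon> v = 0}"
    and exact_Suc: "d (Suc i) ` fpow (J (Suc (Suc i))) 0 = {v \<in> fpow (J (Suc i)) 0. d i v = 0}"
begin

lemmas d_simps = module_hom.add[OF linear_d] module_hom.diff[OF linear_d]
  module_hom.scale[OF linear_d] module_hom.neg[OF linear_d] module_hom.zero[OF linear_d]

lemmas aug_simps = module_hom.add[OF linear_aug] module_hom.diff[OF linear_aug]
  module_hom.scale[OF linear_aug] module_hom.neg[OF linear_aug] module_hom.zero[OF linear_aug]

lemma d_fpow: "v \<in> fpow (J (Suc i)) s \<Longrightarrow> d i v \<in> fpow (J i) (s + 1)"
  by (rule linear_map_fpow[OF linear_d finite_J d_minimal])

lemma d_in: "v \<in> fpow (J (Suc i)) 0 \<Longrightarrow> d i v \<in> fpow (J i) 0"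
  by (rule fpow_antimono[OF d_minimal]) simp_all

lemma d_d: "v \<in> fpow (J (Suc (Suc i))) 0 \<Longrightarrow> d i (d (Suc i) v) = 0"
  using exact_Suc[of i] by blast

lemma aug_d: "v \<in> fpow (J 1) 0 \<Longrightarrow> \<epsilon> (d 0 v) = 0"
  using exact_0 by blast

lemma aug_in: "v \<in> fpow (J 0) 0 \<Longrightarrow> \<epsilon> v \<in> M"
  using aug_image by blast

lemma cycle_boundary:
  assumes "v \<in> fpow (J (Suc i)) 0" "d i v = 0"
  obtains w where "w \<in> fpow (J (Suc (Suc i))) 0" "d (Suc i) w = v"
proof -
  have "v \<in> d (Suc i) ` fpow (J (Suc (Suc i))) 0"
    unfolding exact_Suc using assms by simp
  then show thesis using that by blast
qed

lemma cycle_boundary_0: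
  assumes "v \<in> fpow (J 0) 0" "\<epsilon> v = 0"
  obtains w where "w \<in> fpow (J 1) 0" "d 0 w = v"
proof -
  have "v \<in> d 0 ` fpow (J 1) 0"
    unfolding exact_0 using assms by simp
  then show thesis using that by blast
qed

lemma aug_preimage:
  assumes "f \<in> M"
  obtains v where "v \<in> fpow (J 0) 0" "\<epsilon> v = f"
  using assms unfolding aug_image[symmetric] by blast

lemma aug_image_fpow: "\<epsilon> ` fpow (J 0) s = ideal_smult (*) (mpow s) M"
  unfolding aug_image[symmetric] by (rule linear_form_image_fpow[OF linear_aug finite_J])

text \<open>Vanishing of the homology of the linear part in all positive degrees, on representatives.  The
  class of \<open>v \<in> \<mm>\<^sup>s F\<close> in degree \<open>i + 1\<close> is a cycle when \<open>d v\<close> has order at least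
  \<open>s + 2\<close>, one more than minimality guarantees, and it is a boundary when \<open>v\<close> agrees
  modulo \<open>\<mm>\<^sup>s\<^sup>+\<^sup>1 F\<close> with some \<open>d w\<close>, \<open>w \<in> \<mm>\<^sup>s\<^sup>-\<^sup>1 F\<close>.  The truncation of
  \<open>s - 1\<close> at \<open>s = 0\<close> is harmless: boundaries lie in \<open>\<mm> F\<close>, so for \<open>s = 0\<close>
  the condition says that \<open>v \<in> \<mm> F\<close>.\<close>

definition linear_part_acyclic :: bool where
  "linear_part_acyclic \<longleftrightarrow> (\<forall>i s. \<forall>v\<in>fpow (J (Suc i)) s. d i v \<in> fpow (J i) (s + 2) \<longrightarrow>
     (\<exists>w\<in>fpow (J (Suc (Suc i))) (s - 1). v - d (Suc i) w \<in> fpow (J (Suc i)) (s + 1)))"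

lemma linear_part_acyclicD:
  assumes "linear_part_acyclic" "v \<in> fpow (J (Suc i)) s" "d i v \<in> fpow (J i) (s + 2)"
  obtains w where "w \<in> fpow (J (Suc (Suc i))) (s - 1)" "v - d (Suc i) w \<in> fpow (J (Suc i)) (s + 1)"
  using assms unfolding linear_part_acyclic_def by blast

text \<open>If the linear part is acyclic, the differential is strict: a boundary of order \<open>s + 1\<close> is the
  boundary of a chain of order \<open>s\<close>.  A chain of too small an order is a cycle of the linear part,
  so subtracting a boundary from it improves its order by one.\<close>

lemma boundary_lift:
  assumes ac: "linear_part_acyclic" and v: "v \<in> fpow (J (Suc i)) 0" "d i v \<in> fpow (J i) (s + 1)"
  shows "\<exists>w\<in>fpow (J (Suc i)) s. d i w = d i v"
  using v(2)
proof (induction s)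
  case 0
  then show ?case using v(1) by blast
next
  case (Suc s)
  then obtain w where w: "w \<in> fpow (J (Suc i)) s" "d i w = d i v"
    using fpow_antimono[OF Suc.prems, of "s + 1"] by auto
  then obtain z where z: "z \<in> fpow (J (Suc (Suc i))) (s - 1)"
      "w - d (Suc i) z \<in> fpow (J (Suc i)) (s + 1)"
    using Suc.prems linear_part_acyclicD[OF ac, of w i s] by auto
  have "d i (w - d (Suc i) z) = d i v"
    using d_d[OF fpow_antimono[OF z(1) le0]] w(2) by (simp add: d_simps)
  then show ?case using z(2) by auto
qed

end

text \<open>The comparison theorem.  The step of the recursion needs to know about the current map \<open>g\<close> only
  that \<open>g \<circ> d\<close> takes values in boundaries, and this is the invariant.\<close>

lemma chain_map_exists:
  assumes "minimal_resolution J d \<epsilon> M" and "minimal_resolution K e \<eta> N" and MN: "M \<subseteq> N"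
  obtains f where "\<And>i. linear_map (f i)"
    and "\<And>i v. v \<in> fpow (J i) 0 \<Longrightarrow> f i v \<in> fpow (K i) 0"
    and "\<And>v. v \<in> fpow (J 0) 0 \<Longrightarrow> \<eta> (f 0 v) = \<epsilon> v"
    and "\<And>i v. v \<in> fpow (J (Suc i)) 0 \<Longrightarrow> e i (f (Suc i) v) = f i (d i v)"
proof -
  interpret A: minimal_resolution J d \<epsilon> M by fact
  interpret B: minimal_resolution K e \<eta> N by fact
  define P where "P n g \<longleftrightarrow> linear_map g \<and> (\<forall>v\<in>fpow (J n) 0. g v \<in> fpow (K n) 0) \<and>
    (\<forall>v\<in>fpow (J (Suc n)) 0. g (d n v) \<in> e n ` fpow (K (Suc n)) 0) \<and>
    (n = 0 \<longrightarrow> (\<forall>v\<in>fpow (J 0) 0. \<eta> (g v) = \<epsilon> v))" for n g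
  define Q where "Q n g g' \<longleftrightarrow> (\<forall>v\<in>fpow (J (Suc n)) 0. e n (g' v) = g (d n v))" for n g g'
  have base: "\<exists>g. P 0 g"
  proof -
    have "\<epsilon> v \<in> \<eta> ` fpow (K 0) 0" if "v \<in> fpow (J 0) 0" for v
      using A.aug_in[OF that] MN B.aug_image by blast
    then obtain g where g: "linear_map g" "\<And>v. v \<in> fpow (J 0) 0 \<Longrightarrow> g v \<in> fpow (K 0) 0"
        "\<And>v. v \<in> fpow (J 0) 0 \<Longrightarrow> \<eta> (g v) = \<epsilon> v"
      using lift_along[OF A.linear_aug B.linear_aug A.finite_J[of 0], of "K 0"] by blast
    have "g (d 0 v) \<in> e 0 ` fpow (K 1) 0" if "v \<in> fpow (J 1) 0" for v
      unfolding B.exact_0 using g(2,3)[OF A.d_in[of v 0]] A.aug_d[of v] that by simp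
    then have "P 0 g"
      using g by (simp add: P_def)
    then show ?thesis by blast
  qed
  have step: "\<exists>g'. P (Suc n) g' \<and> Q n g g'" if Pg: "P n g" for n g
  proof -
    obtain g' where g': "linear_map g'" "\<And>v. v \<in> fpow (J (Suc n)) 0 \<Longrightarrow> g' v \<in> fpow (K (Suc n)) 0"
        "\<And>v. v \<in> fpow (J (Suc n)) 0 \<Longrightarrow> e n (g' v) = g (d n v)"
      using lift_along[of smul "\<lambda>v. g (d n v)" "e n" "J (Suc n)" "K (Suc n)"]
        Pg linear_map_compose[OF _ A.linear_d] B.linear_d by (auto simp: P_def)
    have "g' (d (Suc n) v) \<in> e (Suc n) ` fpow (K (Suc (Suc n))) 0"
      if "v \<in> fpow (J (Suc (Suc n))) 0" for v
      unfolding B.exact_Suc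
      using g'(2,3)[OF A.d_in[OF that]] A.d_d[OF that] Pg
      by (simp add: P_def module_hom.zero[of smul smul g])
    then show ?thesis
      using g' by (auto simp: P_def Q_def)
  qed
  obtain f where "\<And>n. P n (f n)" "\<And>n. Q n (f n) (f (Suc n))"
    using dependent_nat_choice[of P Q, OF base step] by blast
  then show thesis
    using that[of f] unfolding P_def Q_def by blast
qed

text \<open>A chain map that induces zero on the resolved module is null-homotopic.\<close>

lemma null_homotopy_exists:
  assumes "minimal_resolution J d \<epsilon> M" and "minimal_resolution K e \<eta> N"
    and lin: "\<And>i. linear_map (u i)"
    and u_in: "\<And>i v. v \<in> fpow (J i) 0 \<Longrightarrow> u i v \<in> fpow (K i) 0"
    and u_aug: "\<And>v. v \<in> fpow (J 0) 0 \<Longrightarrow> \<eta> (u 0 v) = 0"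
    and u_d: "\<And>i v. v \<in> fpow (J (Suc i)) 0 \<Longrightarrow> e i (u (Suc i) v) = u i (d i v)"
  obtains h where "\<And>i. linear_map (h i)"
    and "\<And>i v. v \<in> fpow (J i) 0 \<Longrightarrow> h i v \<in> fpow (K (Suc i)) 0"
    and "\<And>i v. v \<in> fpow (J (Suc i)) 0 \<Longrightarrow> e (Suc i) (h (Suc i) v) = u (Suc i) v - h i (d i v)"
proof -
  interpret A: minimal_resolution J d \<epsilon> M by fact
  interpret B: minimal_resolution K e \<eta> N by fact
  define P where "P n h \<longleftrightarrow> linear_map h \<and> (\<forall>v\<in>fpow (J n) 0. h v \<in> fpow (K (Suc n)) 0) \<and>
    (\<forall>v\<in>fpow (J (Suc n)) 0. u (Suc n) v - h (d n v) \<in> e (Suc n) ` fpow (K (Suc (Suc n))) 0)" for n h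
  define Q where "Q n h h' \<longleftrightarrow>
    (\<forall>v\<in>fpow (J (Suc n)) 0. e (Suc n) (h' v) = u (Suc n) v - h (d n v))" for n h h'
  have base: "\<exists>h. P 0 h"
  proof -
    have "u 0 v \<in> e 0 ` fpow (K 1) 0" if "v \<in> fpow (J 0) 0" for v
      unfolding B.exact_0 using u_in u_aug that by simp
    then obtain h where h: "linear_map h" "\<And>v. v \<in> fpow (J 0) 0 \<Longrightarrow> h v \<in> fpow (K 1) 0"
        "\<And>v. v \<in> fpow (J 0) 0 \<Longrightarrow> e 0 (h v) = u 0 v"
      using lift_along[OF lin[of 0] B.linear_d[of 0] A.finite_J[of 0], of "K 1"] by blast
    have "u 1 v - h (d 0 v) \<in> e 1 ` fpow (K 2) 0" if "v \<in> fpow (J 1) 0" for v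
      using B.exact_Suc[of 0] h(2,3)[OF A.d_in[of v 0]] u_d[of v 0] u_in[of v 1] that
      by (simp add: B.d_simps diff_in_fpow numeral_2_eq_2)
    then have "P 0 h"
      using h by (simp add: P_def numeral_2_eq_2)
    then show ?thesis by blast
  qed
  have step: "\<exists>h'. P (Suc n) h' \<and> Q n h h'" if Ph: "P n h" for n h
  proof -
    obtain h' where h': "linear_map h'"
        "\<And>v. v \<in> fpow (J (Suc n)) 0 \<Longrightarrow> h' v \<in> fpow (K (Suc (Suc n))) 0"
        "\<And>v. v \<in> fpow (J (Suc n)) 0 \<Longrightarrow> e (Suc n) (h' v) = u (Suc n) v - h (d n v)"
      using lift_along[of smul "\<lambda>v. u (Suc n) v - h (d n v)" "e (Suc n)" "J (Suc n)" "K (Suc (Suc n))"]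
        Ph linear_map_diff[OF lin linear_map_compose[OF _ A.linear_d]] B.linear_d by (auto simp: P_def)
    have "u (Suc (Suc n)) v - h' (d (Suc n) v) \<in> e (Suc (Suc n)) ` fpow (K (Suc (Suc (Suc n)))) 0"
      if v: "v \<in> fpow (J (Suc (Suc n))) 0" for v
      unfolding B.exact_Suc
      using h'(2,3)[OF A.d_in[OF v]] A.d_d[OF v] Ph u_d[OF v] u_in[OF v]
      by (simp add: P_def module_hom.zero[of smul smul h] B.d_simps diff_in_fpow)
    then show ?thesis
      using h' by (auto simp: P_def Q_def)
  qed
  obtain h where "\<And>n. P n (h n)" "\<And>n. Q n (h n) (h (Suc n))"
    using dependent_nat_choice[of P Q, OF base step] by blast
  then show thesis
    using that[of h] unfolding P_def Q_def by blast
qed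

text \<open>Comparison maps \<open>f\<close>, \<open>g\<close> between two minimal resolutions of one module preserve orders, and so
  does a homotopy \<open>h\<close> from \<open>g \<circ> f\<close> to the identity.  The differential raises orders,
  so \<open>e \<circ> h + h \<circ> e\<close> is zero on the associated graded pieces, and \<open>g \<circ> f\<close> is the
  identity there.  Thus a class of the linear part that \<open>f\<close> sends to a boundary is a boundary.\<close>

lemma linear_part_acyclic_transfer:
  fixes J :: "nat \<Rightarrow> 'b set" and K :: "nat \<Rightarrow> 'c set" and M :: "('x::finite, 'k::field) mpoly set"
  assumes "minimal_resolution J d \<epsilon> M" and "minimal_resolution K e \<eta> M"
    and ac: "minimal_resolution.linear_part_acyclic J d"
  shows "minimal_resolution.linear_part_acyclic K e"
proof -
  interpret A: minimal_resolution J d \<epsilon> M by fact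
  interpret B: minimal_resolution K e \<eta> M by fact
  obtain f where f: "\<And>i. linear_map (f i)"
      "\<And>i v. v \<in> fpow (K i) 0 \<Longrightarrow> f i v \<in> fpow (J i) 0"
      "\<And>v. v \<in> fpow (K 0) 0 \<Longrightarrow> \<epsilon> (f 0 v) = \<eta> v"
      "\<And>i v. v \<in> fpow (K (Suc i)) 0 \<Longrightarrow> d i (f (Suc i) v) = f i (e i v)"
    using chain_map_exists[OF assms(2,1) order_refl] by metis
  obtain g where g: "\<And>i. linear_map (g i)"
      "\<And>i v. v \<in> fpow (J i) 0 \<Longrightarrow> g i v \<in> fpow (K i) 0"
      "\<And>v. v \<in> fpow (J 0) 0 \<Longrightarrow> \<eta> (g 0 v) = \<epsilon> v"
      "\<And>i v. v \<in> fpow (J (Suc i)) 0 \<Longrightarrow> e i (g (Suc i) v) = g i (d i v)"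
    using chain_map_exists[OF assms(1,2) order_refl] by metis
  define u where "u i v = g i (f i v) - v" for i v
  have id: "linear_map (\<lambda>v :: 'c \<Rightarrow> ('x, 'k) mpoly. v)"
    by (rule linear_mapI) auto
  have u: "\<And>i. linear_map (u i)"
      "\<And>i v. v \<in> fpow (K i) 0 \<Longrightarrow> u i v \<in> fpow (K i) 0"
      "\<And>v. v \<in> fpow (K 0) 0 \<Longrightarrow> \<eta> (u 0 v) = 0"
      "\<And>i v. v \<in> fpow (K (Suc i)) 0 \<Longrightarrow> e i (u (Suc i) v) = u i (e i v)"
    unfolding u_def
    by (rule linear_map_diff[OF linear_map_compose[OF g(1) f(1)] id])
      (simp_all add: diff_in_fpow f g B.aug_simps B.d_simps)
  obtain h where h: "\<And>i. linear_map (h i)"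
      "\<And>i v. v \<in> fpow (K i) 0 \<Longrightarrow> h i v \<in> fpow (K (Suc i)) 0"
      "\<And>i v. v \<in> fpow (K (Suc i)) 0 \<Longrightarrow> e (Suc i) (h (Suc i) v) = u (Suc i) v - h i (e i v)"
    using null_homotopy_exists[OF assms(2,2) u] by metis
  have f_pow: "f i v \<in> fpow (J i) s" if "v \<in> fpow (K i) s" for i v s
    using linear_map_fpow[OF f(1) B.finite_J f(2) that] by simp
  have g_pow: "g i v \<in> fpow (K i) s" if "v \<in> fpow (J i) s" for i v s
    using linear_map_fpow[OF g(1) A.finite_J g(2) that] by simp
  have h_pow: "h i v \<in> fpow (K (Suc i)) s" if "v \<in> fpow (K i) s" for i v s
    using linear_map_fpow[OF h(1) B.finite_J h(2) that] by simp
  show ?thesis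
    unfolding B.linear_part_acyclic_def
  proof (intro allI ballI impI)
    fix i s v assume v: "v \<in> fpow (K (Suc i)) s" and ev: "e i v \<in> fpow (K i) (s + 2)"
    have v0: "v \<in> fpow (K (Suc i)) 0" using v by (rule fpow_antimono) simp
    have "d i (f (Suc i) v) \<in> fpow (J i) (s + 2)"
      using f_pow[OF ev] f(4)[OF v0] by simp
    then obtain w where w: "w \<in> fpow (J (Suc (Suc i))) (s - 1)"
        "f (Suc i) v - d (Suc i) w \<in> fpow (J (Suc i)) (s + 1)"
      using A.linear_part_acyclicD[OF ac f_pow[OF v]] by blast
    have w0: "w \<in> fpow (J (Suc (Suc i))) 0" using w(1) by (rule fpow_antimono) simp
    \<comment> \<open>Substitute \<open>v = g (f v) - e (h v) - h (e v)\<close>.\<close>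
    have "v - e (Suc i) (g (Suc (Suc i)) w) =
        g (Suc i) (f (Suc i) v - d (Suc i) w) - e (Suc i) (h (Suc i) v) - h i (e i v)"
      using h(3)[OF v0] g(4)[OF w0] by (simp add: u_def module_hom.diff[OF g(1)])
    also have "\<dots> \<in> fpow (K (Suc i)) (s + 1)"
      by (intro diff_in_fpow g_pow w(2) B.d_fpow h_pow v fpow_antimono[OF h_pow[OF ev]]) simp
    finally show "\<exists>w\<in>fpow (K (Suc (Suc i))) (s - 1). v - e (Suc i) w \<in> fpow (K (Suc i)) (s + 1)"
      using g_pow[OF w(1)] by blast
  qed
qed


section \<open>The mapping cone of the sum\<close>

definition triple :: "('a \<Rightarrow> 'r) \<Rightarrow> ('b \<Rightarrow> 'r) \<Rightarrow> ('c \<Rightarrow> 'r) \<Rightarrow> 'a + 'b + 'c \<Rightarrow> 'r" where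
  "triple a b c = case_sum a (case_sum b c)"

lemma triple_surj: obtains a b c where "v = triple a b c"
proof
  show "v = triple (\<lambda>j. v (Inl j)) (\<lambda>j. v (Inr (Inl j))) (\<lambda>j. v (Inr (Inr j)))"
    by (auto simp: triple_def fun_eq_iff split: sum.split)
qed

lemma triple_eq_iff [simp]: "triple a b c = triple a' b' c' \<longleftrightarrow> a = a' \<and> b = b' \<and> c = c'"
  by (simp add: triple_def fun_eq_iff split_sum_all)

lemma triple_add [simp]: "triple a b c + triple a' b' c' = triple (a + a') (b + b') (c + c')"
  by (simp add: triple_def fun_eq_iff split_sum_all)

lemma triple_diff [simp]: "triple a b c - triple a' b' c' = triple (a - a') (b - b') (c - c')"
  by (simp add: triple_def fun_eq_iff split_sum_all)

lemma triple_smul [simp]: "smul r (triple a b c) = triple (smul r a) (smul r b) (smul r c)"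
  by (simp add: triple_def fun_eq_iff split_sum_all)

lemma triple_zero [simp]: "triple a b c = 0 \<longleftrightarrow> a = 0 \<and> b = 0 \<and> c = 0"
  by (simp add: triple_def fun_eq_iff split_sum_all)

lemma triple_in_fpow [simp]:
  "triple a b c \<in> fpow (A <+> (B <+> C)) s \<longleftrightarrow> a \<in> fpow A s \<and> b \<in> fpow B s \<and> c \<in> fpow C s"
  by (auto simp: triple_def fpow_def split_sum_all)

lemma fpow_empty: "a \<in> fpow {} s \<longleftrightarrow> a = 0"
  by (auto simp: fpow_def fun_eq_iff)

text \<open>Here \<open>J\<close>, \<open>d\<close> is a minimal resolution of \<open>T\<close>, and \<open>K\<close>, \<open>e\<close> one of an ideal
  \<open>N\<close> that contains \<open>T\<close>; \<open>\<phi>\<close> lifts the inclusion.  By the assumption \<open>colon\<close>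
  (which follows if \<open>x\<close> is regular on the ring modulo \<open>T\<close>) the ideals \<open>x N\<close> and \<open>T\<close> meet in
  \<open>x T\<close>, so that \<open>x N + T\<close> is the cokernel of \<open>T \<rightarrow> N \<oplus> T\<close>, \<open>t \<mapsto> (t, - x t)\<close>.
  It is therefore resolved by the mapping cone of \<open>(\<phi>, - x)\<close>, and the cone is minimal because
  \<open>\<phi>\<close> and multiplication by \<open>x\<close> take values in \<open>\<mm>\<close> times their targets.\<close>

locale sum_cone = A: minimal_resolution J d \<epsilon> T + B: minimal_resolution K e \<eta> N
  for J :: "nat \<Rightarrow> 'a set"
    and d :: "nat \<Rightarrow> ('a \<Rightarrow> ('x::finite, 'k::field) mpoly) \<Rightarrow> 'a \<Rightarrow> ('x, 'k) mpoly"
    and \<epsilon> T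
    and K :: "nat \<Rightarrow> 'b set"
    and e :: "nat \<Rightarrow> ('b \<Rightarrow> ('x, 'k) mpoly) \<Rightarrow> 'b \<Rightarrow> ('x, 'k) mpoly"
    and \<eta> N +
  fixes x :: "('x, 'k) mpoly"
    and \<phi> :: "nat \<Rightarrow> ('a \<Rightarrow> ('x, 'k) mpoly) \<Rightarrow> 'b \<Rightarrow> ('x, 'k) mpoly"
  assumes x: "x \<in> mpow 1"
    and linear_\<phi>: "linear_map (\<phi> i)"
    and \<phi>_minimal: "v \<in> fpow (J i) 0 \<Longrightarrow> \<phi> i v \<in> fpow (K i) 1"
    and \<phi>_aug: "v \<in> fpow (J 0) 0 \<Longrightarrow> \<eta> (\<phi> 0 v) = \<epsilon> v"
    and \<phi>_d: "v \<in> fpow (J (Suc i)) 0 \<Longrightarrow> e i (\<phi> (Suc i) v) = \<phi> i (d i v)"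
    and colon: "f \<in> N \<Longrightarrow> x * f \<in> T \<Longrightarrow> f \<in> T"
begin

lemmas \<phi>_simps = module_hom.add[OF linear_\<phi>] module_hom.diff[OF linear_\<phi>]
  module_hom.scale[OF linear_\<phi>] module_hom.neg[OF linear_\<phi>] module_hom.zero[OF linear_\<phi>]

lemma \<phi>_fpow: "v \<in> fpow (J i) s \<Longrightarrow> \<phi> i v \<in> fpow (K i) (s + 1)"
  by (rule linear_map_fpow[OF linear_\<phi> A.finite_J \<phi>_minimal])

lemma \<phi>_fpow_pred:
  assumes "v \<in> fpow (J i) (s - 1)"
  shows "\<phi> i v \<in> fpow (K i) s"
  using \<phi>_fpow[OF assms] by (rule fpow_antimono) simp

lemma x_fpow: "v \<in> fpow L s \<Longrightarrow> smul x v \<in> fpow L (s + 1)"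
  using smul_in_fpow_add[OF x] by (simp add: add.commute)

lemma x_fpow_pred:
  assumes "v \<in> fpow L (s - 1)"
  shows "smul x v \<in> fpow L s"
  using x_fpow[OF assms] by (rule fpow_antimono) simp

text \<open>In degree \<open>i\<close> the cone is the sum of the resolution of \<open>T\<close> in degree \<open>i - 1\<close>, of
  that of \<open>N\<close> in degree \<open>i\<close>, and of that of \<open>T\<close> in degree \<open>i\<close>; vectors are
  triples \<open>(a, b, c)\<close> accordingly.\<close>

definition cone_index :: "nat \<Rightarrow> ('a + 'b + 'a) set" where
  "cone_index i = (case i of 0 \<Rightarrow> {} | Suc l \<Rightarrow> J l) <+> (K i <+> J i)"

definition cone_d :: "nat \<Rightarrow> ('a + 'b + 'a \<Rightarrow> ('x, 'k) mpoly) \<Rightarrow> 'a + 'b + 'a \<Rightarrow> ('x, 'k) mpoly" where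
  "cone_d i v = (let a = \<lambda>j. v (Inl j); b = \<lambda>j. v (Inr (Inl j)); c = \<lambda>j. v (Inr (Inr j))
     in triple (case i of 0 \<Rightarrow> 0 | Suc l \<Rightarrow> - d l a) (e i b + \<phi> i a) (d i c - smul x a))"

definition cone_aug :: "('a + 'b + 'a \<Rightarrow> ('x, 'k) mpoly) \<Rightarrow> ('x, 'k) mpoly" where
  "cone_aug v = x * \<eta> (\<lambda>j. v (Inr (Inl j))) + \<epsilon> (\<lambda>j. v (Inr (Inr j)))"

lemma cone_d_triple: "cone_d i (triple a b c) =
    triple (case i of 0 \<Rightarrow> 0 | Suc l \<Rightarrow> - d l a) (e i b + \<phi> i a) (d i c - smul x a)"
  by (simp add: cone_d_def triple_def Let_def)

lemma cone_aug_triple: "cone_aug (triple a b c) = x * \<eta> b + \<epsilon> c"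
  by (simp add: cone_aug_def triple_def)

lemma triple_in_cone_0:
  "triple a b c \<in> fpow (cone_index 0) s \<longleftrightarrow> a = 0 \<and> b \<in> fpow (K 0) s \<and> c \<in> fpow (J 0) s"
  by (simp add: cone_index_def fpow_empty)

lemma triple_in_cone_Suc: "triple a b c \<in> fpow (cone_index (Suc i)) s \<longleftrightarrow>
    a \<in> fpow (J i) s \<and> b \<in> fpow (K (Suc i)) s \<and> c \<in> fpow (J (Suc i)) s"
  by (simp add: cone_index_def)

lemma linear_cone_d: "linear_map (cone_d i)"
proof (rule linear_mapI)
  fix v w :: "'a + 'b + 'a \<Rightarrow> ('x, 'k) mpoly" and r
  obtain a b c where v: "v = triple a b c" by (rule triple_surj)
  obtain a' b' c' where w: "w = triple a' b' c'" by (rule triple_surj)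
  show "cone_d i (v + w) = cone_d i v + cone_d i w"
    by (simp add: v w cone_d_triple A.d_simps B.d_simps \<phi>_simps free_module.scale_right_distrib
        split: nat.split)
  show "cone_d i (smul r v) = smul r (cone_d i v)"
    by (simp add: v cone_d_triple A.d_simps B.d_simps \<phi>_simps free_module.scale_right_distrib
        free_module.scale_right_diff_distrib mult.commute split: nat.split)
qed

lemma linear_cone_aug: "linear_form cone_aug"
proof (rule linear_formI)
  fix v w :: "'a + 'b + 'a \<Rightarrow> ('x, 'k) mpoly" and r
  obtain a b c where v: "v = triple a b c" by (rule triple_surj)
  obtain a' b' c' where w: "w = triple a' b' c'" by (rule triple_surj)
  show "cone_aug (v + w) = cone_aug v + cone_aug w"
    by (simp add: v w cone_aug_triple A.aug_simps B.aug_simps distrib_left)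
  show "cone_aug (smul r v) = r * cone_aug v"
    by (simp add: v cone_aug_triple A.aug_simps B.aug_simps distrib_left mult.left_commute)
qed

lemma T_subspace: "ring_module.subspace T"
  unfolding A.aug_image[symmetric]
  by (rule module_hom.subspace_image[OF A.linear_aug subspace_fpow])

text \<open>Once the component \<open>a\<close> of a cycle \<open>(a, b, c)\<close> is a boundary \<open>d a'\<close>, subtracting the
  boundary of \<open>(- a', 0, 0)\<close> reduces to the cycles \<open>b + \<phi> a'\<close> and \<open>c - x a'\<close> of the two
  given resolutions.\<close>

lemma lift_to_boundary:
  assumes a: "a \<in> fpow (J i) 0" "d i a' = a" "a' \<in> fpow (J (Suc i)) 0"
    and b: "b \<in> fpow (K (Suc i)) 0" "e i b + \<phi> i a = 0"
    and c: "c \<in> fpow (J (Suc i)) 0" "d i c - smul x a = 0"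
  shows "triple a b c \<in> cone_d (Suc i) ` fpow (cone_index (Suc (Suc i))) 0"
proof -
  have "b - \<phi> (Suc i) (- a') \<in> fpow (K (Suc i)) 0"
    using b(1) a(3) by (intro diff_in_fpow \<phi>_fpow_pred) (auto simp: neg_in_fpow)
  moreover have "e i (b - \<phi> (Suc i) (- a')) = 0"
    using b(2) a(2,3) \<phi>_d[OF a(3)] by (simp add: B.d_simps \<phi>_simps)
  ultimately obtain b' where b': "b' \<in> fpow (K (Suc (Suc i))) 0" "e (Suc i) b' = b - \<phi> (Suc i) (- a')"
    by (rule B.cycle_boundary)
  have "c + smul x (- a') \<in> fpow (J (Suc i)) 0"
    using c(1) a(3) by (intro add_in_fpow smul_in_fpow neg_in_fpow)
  moreover have "d i (c + smul x (- a')) = 0"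
    using c(2) a(2) by (simp add: A.d_simps)
  ultimately obtain c' where c': "c' \<in> fpow (J (Suc (Suc i))) 0" "d (Suc i) c' = c + smul x (- a')"
    by (rule A.cycle_boundary)
  have "triple a b c = cone_d (Suc i) (triple (- a') b' c')"
    using a(2) b'(2) c'(2) by (simp add: cone_d_triple A.d_simps \<phi>_simps)
  moreover have "triple (- a') b' c' \<in> fpow (cone_index (Suc (Suc i))) 0"
    using a(3) b'(1) c'(1) by (simp add: triple_in_cone_Suc neg_in_fpow)
  ultimately show ?thesis by blast
qed

lemma cone_d_d:
  assumes "v \<in> fpow (cone_index (Suc (Suc i))) 0"
  shows "cone_d i (cone_d (Suc i) v) = 0"
proof -
  obtain a b c where v: "v = triple a b c" by (rule triple_surj)
  then have "a \<in> fpow (J (Suc i)) 0" "b \<in> fpow (K (Suc (Suc i))) 0" "c \<in> fpow (J (Suc (Suc i))) 0"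
    using assms by (simp_all add: triple_in_cone_Suc)
  then show ?thesis
    by (cases i) (simp_all add: v cone_d_triple A.d_simps B.d_simps \<phi>_simps A.d_d B.d_d \<phi>_d)
qed

lemma cone_minimal:
  assumes "v \<in> fpow (cone_index (Suc i)) 0"
  shows "cone_d i v \<in> fpow (cone_index i) 1"
proof -
  obtain a b c where v: "v = triple a b c" by (rule triple_surj)
  then have abc: "a \<in> fpow (J i) 0" "b \<in> fpow (K (Suc i)) 0" "c \<in> fpow (J (Suc i)) 0"
    using assms by (simp_all add: triple_in_cone_Suc)
  have "e i b + \<phi> i a \<in> fpow (K i) 1" "d i c - smul x a \<in> fpow (J i) 1"
    using abc B.d_minimal A.d_minimal \<phi>_minimal x_fpow[of a "J i" 0]
    by (auto intro: add_in_fpow diff_in_fpow)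
  then show ?thesis
    using abc A.d_minimal
    by (cases i) (auto simp: v cone_d_triple triple_in_cone_0 triple_in_cone_Suc intro: neg_in_fpow)
qed

lemma cone_exact_0: "cone_d 0 ` fpow (cone_index 1) 0 = {v \<in> fpow (cone_index 0) 0. cone_aug v = 0}"
proof (intro equalityI subsetI)
  fix v assume "v \<in> cone_d 0 ` fpow (cone_index 1) 0"
  then obtain w where w: "w \<in> fpow (cone_index 1) 0" "v = cone_d 0 w" by blast
  obtain a b c where w': "w = triple a b c" by (rule triple_surj)
  have abc: "a \<in> fpow (J 0) 0" "b \<in> fpow (K 1) 0" "c \<in> fpow (J 1) 0"
    using w(1) by (simp_all add: w' triple_in_cone_Suc)
  have "cone_aug v = 0"
    using abc by (simp add: w w' cone_d_triple cone_aug_triple B.aug_simps A.aug_simps B.aug_d A.aug_d \<phi>_aug)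
  moreover have "v \<in> fpow (cone_index 0) 0"
    using cone_minimal[of w 0] w by (auto intro: fpow_antimono)
  ultimately show "v \<in> {v \<in> fpow (cone_index 0) 0. cone_aug v = 0}" by simp
next
  fix v assume v: "v \<in> {v \<in> fpow (cone_index 0) 0. cone_aug v = 0}"
  obtain a b c where v': "v = triple a b c" by (rule triple_surj)
  have bc: "a = 0" "b \<in> fpow (K 0) 0" "c \<in> fpow (J 0) 0" and eq: "x * \<eta> b + \<epsilon> c = 0"
    using v by (simp_all add: v' triple_in_cone_0 cone_aug_triple)
  \<comment> \<open>Here the intersection of \<open>x N\<close> and \<open>T\<close> is identified with \<open>x T\<close>.\<close>
  have "x * \<eta> b = - \<epsilon> c" using eq by (simp add: eq_neg_iff_add_eq_0)
  also have "\<dots> \<in> T"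
    by (rule ring_module.subspace_neg[OF T_subspace A.aug_in[OF bc(3)]])
  finally have "\<eta> b \<in> T"
    using colon B.aug_in[OF bc(2)] by blast
  then obtain a0 where a0: "a0 \<in> fpow (J 0) 0" "\<epsilon> a0 = \<eta> b"
    by (rule A.aug_preimage)
  have "b - \<phi> 0 a0 \<in> fpow (K 0) 0" "\<eta> (b - \<phi> 0 a0) = 0"
    using bc(2) a0 \<phi>_fpow[OF a0(1)] by (auto simp: B.aug_simps \<phi>_aug intro: diff_in_fpow fpow_antimono)
  then obtain b' where b': "b' \<in> fpow (K 1) 0" "e 0 b' = b - \<phi> 0 a0"
    by (auto elim: B.cycle_boundary_0)
  have "c + smul x a0 \<in> fpow (J 0) 0" "\<epsilon> (c + smul x a0) = 0"
    using bc(3) a0 eq by (auto simp: A.aug_simps add.commute intro: add_in_fpow smul_in_fpow)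
  then obtain c' where c': "c' \<in> fpow (J 1) 0" "d 0 c' = c + smul x a0"
    by (auto elim: A.cycle_boundary_0)
  have "v = cone_d 0 (triple a0 b' c')"
    by (simp add: v' bc cone_d_triple b' c')
  moreover have "triple a0 b' c' \<in> fpow (cone_index 1) 0"
    using a0 b' c' by (simp add: triple_in_cone_Suc)
  ultimately show "v \<in> cone_d 0 ` fpow (cone_index 1) 0" by blast
qed

lemma cone_exact_Suc: "cone_d (Suc i) ` fpow (cone_index (Suc (Suc i))) 0 =
    {v \<in> fpow (cone_index (Suc i)) 0. cone_d i v = 0}"
proof (intro equalityI subsetI)
  fix v assume "v \<in> cone_d (Suc i) ` fpow (cone_index (Suc (Suc i))) 0"
  then show "v \<in> {v \<in> fpow (cone_index (Suc i)) 0. cone_d i v = 0}"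
    using cone_d_d fpow_antimono[OF cone_minimal le0] by auto
next
  fix v assume v: "v \<in> {v \<in> fpow (cone_index (Suc i)) 0. cone_d i v = 0}"
  obtain a b c where v': "v = triple a b c" by (rule triple_surj)
  have abc: "a \<in> fpow (J i) 0" "b \<in> fpow (K (Suc i)) 0" "c \<in> fpow (J (Suc i)) 0"
    and eqs: "(case i of 0 \<Rightarrow> 0 | Suc l \<Rightarrow> - d l a) = 0" "e i b + \<phi> i a = 0" "d i c - smul x a = 0"
    using v by (simp_all add: v' triple_in_cone_Suc cone_d_triple)
  have "a \<in> d i ` fpow (J (Suc i)) 0"
  proof (cases i)
    case 0
    have "\<phi> 0 a = - e 0 b"
      using eqs(2) by (simp add: 0 eq_neg_iff_add_eq_0 add.commute)
    then have "\<eta> (\<phi> 0 a) = \<eta> (- e 0 b)" by simp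
    then have "\<epsilon> a = 0"
      using abc by (simp add: 0 \<phi>_aug B.aug_simps B.aug_d)
    then show ?thesis using abc A.exact_0 by (simp add: 0)
  next
    case (Suc l)
    then show ?thesis using abc eqs A.exact_Suc[of l] by simp
  qed
  then obtain a' where "a' \<in> fpow (J (Suc i)) 0" "d i a' = a" by blast
  then show "v \<in> cone_d (Suc i) ` fpow (cone_index (Suc (Suc i))) 0"
    unfolding v' using abc eqs by (intro lift_to_boundary)
qed

lemma cone_aug_image: "cone_aug ` fpow (cone_index 0) 0 = (*) x ` N + T"
proof (intro equalityI subsetI)
  fix f assume "f \<in> cone_aug ` fpow (cone_index 0) 0"
  then obtain v where v: "v \<in> fpow (cone_index 0) 0" "f = cone_aug v" by blast
  obtain a b c where v': "v = triple a b c" by (rule triple_surj)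
  show "f \<in> (*) x ` N + T"
    using v by (auto simp: v' triple_in_cone_0 cone_aug_triple A.aug_in B.aug_in)
next
  fix f assume "f \<in> (*) x ` N + T"
  then obtain g t where f: "f = x * g + t" "g \<in> N" "t \<in> T"
    by (auto elim: set_plus_elim)
  then obtain b c where "b \<in> fpow (K 0) 0" "c \<in> fpow (J 0) 0" "g = \<eta> b" "t = \<epsilon> c"
    using A.aug_preimage[of t] B.aug_preimage[of g] by metis
  then have "f = cone_aug (triple 0 b c)" "triple 0 b c \<in> fpow (cone_index 0) 0"
    using f by (simp_all add: cone_aug_triple triple_in_cone_0)
  then show "f \<in> cone_aug ` fpow (cone_index 0) 0" by blast
qed

sublocale cone: minimal_resolution cone_index cone_d cone_aug "(*) x ` N + T"
proof (rule minimal_resolution.intro)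
  show "finite (cone_index i)" for i
    by (cases i) (simp_all add: cone_index_def)
qed (fact linear_cone_d linear_cone_aug cone_minimal cone_aug_image cone_exact_0 cone_exact_Suc)+

text \<open>The long exact sequence of the cone says that multiplication by \<open>x\<close> is onto on the positive
  homology of the linear part for \<open>T\<close>.  Since \<open>x\<close> raises orders, a class of order \<open>s\<close> comes
  from one of order \<open>s - 1\<close>, and there is none below order \<open>0\<close>: a Nakayama argument, run as an
  induction on \<open>s\<close>.\<close>

lemma cone_acyclic_imp_acyclic:
  assumes ac: "cone.linear_part_acyclic"
  shows "A.linear_part_acyclic"
proof -
  have "\<exists>w\<in>fpow (J (Suc (Suc i))) (s - 1). c - d (Suc i) w \<in> fpow (J (Suc i)) (s + 1)"
    if "c \<in> fpow (J (Suc i)) s" "d i c \<in> fpow (J i) (s + 2)" for i s c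
    using that
  proof (induction s arbitrary: c)
    case (0 c)
    have "triple 0 0 c \<in> fpow (cone_index (Suc i)) 0"
      using 0(1) by (simp add: triple_in_cone_Suc)
    moreover have "cone_d i (triple 0 0 c) \<in> fpow (cone_index i) (0 + 2)"
      using 0(2) by (cases i) (simp_all add: cone_d_triple triple_in_cone_0 triple_in_cone_Suc
        A.d_simps B.d_simps \<phi>_simps)
    ultimately obtain w where w: "w \<in> fpow (cone_index (Suc (Suc i))) (0 - 1)"
        "triple 0 0 c - cone_d (Suc i) w \<in> fpow (cone_index (Suc i)) (0 + 1)"
      using cone.linear_part_acyclicD[OF ac] by metis
    obtain a' b' c' where w': "w = triple a' b' c'" by (rule triple_surj)
    have a': "a' \<in> fpow (J (Suc i)) 0" and c': "c' \<in> fpow (J (Suc (Suc i))) 0"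
      and eq: "c - (d (Suc i) c' - smul x a') \<in> fpow (J (Suc i)) 1"
      using w by (simp_all add: w' triple_in_cone_Suc cone_d_triple)
    have "c - d (Suc i) c' = (c - (d (Suc i) c' - smul x a')) - smul x a'" by simp
    also have "\<dots> \<in> fpow (J (Suc i)) (0 + 1)"
      by (rule diff_in_fpow) (use eq x_fpow[OF a'] in simp_all)
    finally have "c - d (Suc i) c' \<in> fpow (J (Suc i)) (0 + 1)" .
    moreover have "c' \<in> fpow (J (Suc (Suc i))) (0 - 1)"
      using c' by simp
    ultimately show ?case by blast
  next
    case (Suc s c)
    have "triple 0 0 c \<in> fpow (cone_index (Suc i)) (Suc s)"
      using Suc.prems(1) by (simp add: triple_in_cone_Suc)
    moreover have "cone_d i (triple 0 0 c) \<in> fpow (cone_index i) (Suc s + 2)"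
      using Suc.prems(2) by (cases i) (simp_all add: cone_d_triple triple_in_cone_0 triple_in_cone_Suc
        A.d_simps B.d_simps \<phi>_simps)
    ultimately obtain w where w: "w \<in> fpow (cone_index (Suc (Suc i))) (Suc s - 1)"
        "triple 0 0 c - cone_d (Suc i) w \<in> fpow (cone_index (Suc i)) (Suc s + 1)"
      using cone.linear_part_acyclicD[OF ac] by metis
    obtain a' b' c' where w': "w = triple a' b' c'" by (rule triple_surj)
    have a': "a' \<in> fpow (J (Suc i)) s" "d i a' \<in> fpow (J i) (s + 2)"
      and c': "c' \<in> fpow (J (Suc (Suc i))) s"
      and eq: "c - (d (Suc i) c' - smul x a') \<in> fpow (J (Suc i)) (s + 2)"
      using w by (simp_all add: w' triple_in_cone_Suc cone_d_triple)
    obtain a'' where a'': "a'' \<in> fpow (J (Suc (Suc i))) (s - 1)"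
        "a' - d (Suc i) a'' \<in> fpow (J (Suc i)) (s + 1)"
      using Suc.IH[OF a'] by blast
    have "c - d (Suc i) (c' - smul x a'') =
        (c - (d (Suc i) c' - smul x a')) - smul x (a' - d (Suc i) a'')"
      by (simp add: A.d_simps free_module.scale_right_diff_distrib)
    also have "\<dots> \<in> fpow (J (Suc i)) (Suc s + 1)"
      by (rule diff_in_fpow) (use eq x_fpow[OF a''(2)] in simp_all)
    finally have "c - d (Suc i) (c' - smul x a'') \<in> fpow (J (Suc i)) (Suc s + 1)" .
    moreover have "c' - smul x a'' \<in> fpow (J (Suc (Suc i))) (Suc s - 1)"
      using diff_in_fpow[OF c' x_fpow_pred[OF a''(1)]] by simp
    ultimately show ?case by blast
  qed
  then show ?thesis
    unfolding A.linear_part_acyclic_def by blast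
qed

text \<open>The long exact sequence again: above degree \<open>1\<close> the homology of the linear part of the cone lies
  between positive homologies of the two given linear parts.  In degree \<open>1\<close> it embeds in the kernel
  of \<open>x\<close> on the \<open>\<mm>\<close>-adic associated graded module of \<open>T\<close>, which \<open>gr\<close> makes trivial.\<close>

lemma acyclic_imp_cone_acyclic:
  assumes acA: "A.linear_part_acyclic" and acB: "B.linear_part_acyclic"
    and gr: "\<And>s f. f \<in> \<epsilon> ` fpow (J 0) s \<Longrightarrow> x * f \<in> \<epsilon> ` fpow (J 0) (s + 2) \<Longrightarrow>
      f \<in> \<epsilon> ` fpow (J 0) (s + 1)"
  shows "cone.linear_part_acyclic"
  unfolding cone.linear_part_acyclic_def
proof (intro allI ballI impI)
  fix i s v
  assume v: "v \<in> fpow (cone_index (Suc i)) s" "cone_d i v \<in> fpow (cone_index i) (s + 2)"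
  obtain a b c where v': "v = triple a b c" by (rule triple_surj)
  have abc: "a \<in> fpow (J i) s" "b \<in> fpow (K (Suc i)) s" "c \<in> fpow (J (Suc i)) s"
    using v(1) by (simp_all add: v' triple_in_cone_Suc)
  have db: "e i b + \<phi> i a \<in> fpow (K i) (s + 2)" and dc: "d i c - smul x a \<in> fpow (J i) (s + 2)"
    using v(2) by (cases i; simp add: v' cone_d_triple triple_in_cone_Suc triple_in_cone_0)+
  \<comment> \<open>The component \<open>a\<close> is a boundary of the linear part; the rest of the proof lifts this to
    the triple.\<close>
  have "\<exists>a'\<in>fpow (J (Suc i)) (s - 1). a - d i a' \<in> fpow (J i) (s + 1)"
  proof (cases i)
    case (Suc l)
    have "- d l a \<in> fpow (J l) (s + 2)"
      using v(2) by (simp add: Suc v' cone_d_triple triple_in_cone_Suc)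
    then have "d l a \<in> fpow (J l) (s + 2)"
      using neg_in_fpow by fastforce
    then show ?thesis
      using A.linear_part_acyclicD[OF acA, of a l s] abc(1) unfolding Suc by blast
  next
    case 0
    have "x * \<epsilon> a = \<epsilon> (- (d 0 c - smul x a))"
      using A.aug_d[of c] fpow_antimono[OF abc(3) le0] by (simp add: 0 A.aug_simps)
    also have "\<dots> \<in> \<epsilon> ` fpow (J 0) (s + 2)"
      using neg_in_fpow[OF dc] by (simp only: 0 imageI)
    finally have "\<epsilon> a \<in> \<epsilon> ` fpow (J 0) (s + 1)"
      using gr abc(1) by (simp add: 0)
    then obtain a1 where a1: "a1 \<in> fpow (J 0) (s + 1)" "\<epsilon> a1 = \<epsilon> a" by (metis imageE)
    have diff: "a - a1 \<in> fpow (J 0) s"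
      using abc(1) fpow_antimono[OF a1(1), of s] by (simp add: 0 diff_in_fpow)
    then have "a - a1 \<in> d 0 ` fpow (J 1) 0"
      unfolding A.exact_0 using a1(2) by (auto simp: A.aug_simps intro: fpow_antimono)
    then obtain a0 where a0: "a0 \<in> fpow (J 1) 0" "d 0 a0 = a - a1" by (metis imageE)
    \<comment> \<open>The chain \<open>a0\<close> may have too small an order, which strictness repairs.\<close>
    obtain a' where a': "a' \<in> fpow (J 1) (s - 1)" "d 0 a' = a - a1"
    proof (cases s)
      case 0
      then show thesis using a0 that by simp
    next
      case (Suc t)
      then show thesis
        using A.boundary_lift[OF acA, of a0 0 t] a0 diff that by auto
    qed
    have "a - d 0 a' \<in> fpow (J 0) (s + 1)"
      using a1(1) a'(2) by simp
    then show ?thesis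
      using a'(1) by (intro bexI[of _ a']) (simp_all add: 0)
  qed
  then obtain a' where a': "a' \<in> fpow (J (Suc i)) (s - 1)" "a - d i a' \<in> fpow (J i) (s + 1)"
    by blast
  have a'0: "a' \<in> fpow (J (Suc i)) 0" using a'(1) by (rule fpow_antimono) simp
  have "b + \<phi> (Suc i) a' \<in> fpow (K (Suc i)) s"
    by (intro add_in_fpow abc(2) \<phi>_fpow_pred a'(1))
  moreover have "e i (b + \<phi> (Suc i) a') = (e i b + \<phi> i a) - \<phi> i (a - d i a')"
    using \<phi>_d[OF a'0] by (simp add: B.d_simps \<phi>_simps)
  then have "e i (b + \<phi> (Suc i) a') \<in> fpow (K i) (s + 2)"
    using diff_in_fpow[OF db] \<phi>_fpow[OF a'(2)] by simp
  ultimately obtain b' where b': "b' \<in> fpow (K (Suc (Suc i))) (s - 1)"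
      "(b + \<phi> (Suc i) a') - e (Suc i) b' \<in> fpow (K (Suc i)) (s + 1)"
    using B.linear_part_acyclicD[OF acB] by metis
  have "c - smul x a' \<in> fpow (J (Suc i)) s"
    by (intro diff_in_fpow abc(3) x_fpow_pred a'(1))
  moreover have "d i (c - smul x a') = (d i c - smul x a) + smul x (a - d i a')"
    by (simp add: A.d_simps free_module.scale_right_diff_distrib)
  then have "d i (c - smul x a') \<in> fpow (J i) (s + 2)"
    using add_in_fpow[OF dc] x_fpow[OF a'(2)] by simp
  ultimately obtain c' where c': "c' \<in> fpow (J (Suc (Suc i))) (s - 1)"
      "(c - smul x a') - d (Suc i) c' \<in> fpow (J (Suc i)) (s + 1)"
    using A.linear_part_acyclicD[OF acA] by metis
  have "triple (- a') b' c' \<in> fpow (cone_index (Suc (Suc i))) (s - 1)"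
    using a' b' c' by (simp add: triple_in_cone_Suc neg_in_fpow)
  moreover have "v - cone_d (Suc i) (triple (- a') b' c') \<in> fpow (cone_index (Suc i)) (s + 1)"
    using a' b' c'
    by (simp add: v' cone_d_triple triple_in_cone_Suc A.d_simps \<phi>_simps algebra_simps)
  ultimately show "\<exists>w\<in>fpow (cone_index (Suc (Suc i))) (s - 1).
      v - cone_d (Suc i) w \<in> fpow (cone_index (Suc i)) (s + 1)"
    by blast
qed

end

text \<open>A lift of the inclusion of \<open>T\<close> in \<open>\<mm> N\<close> is automatically minimal when the linear part for
  \<open>N\<close> is acyclic.  In degree \<open>0\<close> two lifts differ by a boundary, and one of them takes
  values of order at least \<open>1\<close>.  If \<open>\<phi>\<close> raises orders in degree \<open>i\<close>, then \<open>e (\<phi> v) = \<phi> (d v)\<close>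
  has order at least \<open>2\<close>, so \<open>\<phi> v\<close> is a cycle of the linear part of order \<open>0\<close>, that is,
  \<open>\<phi> v\<close> has order at least \<open>1\<close>.\<close>

lemma minimal_chain_map_exists:
  assumes "minimal_resolution J d \<epsilon> T" and "minimal_resolution K e \<eta> N"
    and TN: "T \<subseteq> ideal_smult (*) (mpow 1) N"
    and ac: "minimal_resolution.linear_part_acyclic K e"
  obtains \<phi> where "\<And>i. linear_map (\<phi> i)"
    and "\<And>i v. v \<in> fpow (J i) 0 \<Longrightarrow> \<phi> i v \<in> fpow (K i) 1"
    and "\<And>v. v \<in> fpow (J 0) 0 \<Longrightarrow> \<eta> (\<phi> 0 v) = \<epsilon> v"
    and "\<And>i v. v \<in> fpow (J (Suc i)) 0 \<Longrightarrow> e i (\<phi> (Suc i) v) = \<phi> i (d i v)"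
proof -
  interpret A: minimal_resolution J d \<epsilon> T by fact
  interpret B: minimal_resolution K e \<eta> N by fact
  have T1: "T \<subseteq> \<eta> ` fpow (K 0) 1"
    using TN by (simp only: B.aug_image_fpow)
  also have "\<dots> \<subseteq> N"
    using B.aug_image by (auto intro: fpow_antimono)
  finally obtain f where f: "\<And>i. linear_map (f i)"
      "\<And>i v. v \<in> fpow (J i) 0 \<Longrightarrow> f i v \<in> fpow (K i) 0"
      "\<And>v. v \<in> fpow (J 0) 0 \<Longrightarrow> \<eta> (f 0 v) = \<epsilon> v"
      "\<And>i v. v \<in> fpow (J (Suc i)) 0 \<Longrightarrow> e i (f (Suc i) v) = f i (d i v)"
    using chain_map_exists[OF assms(1,2)] by metis
  have "f i v \<in> fpow (K i) 1" if "v \<in> fpow (J i) 0" for i v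
    using that
  proof (induction i arbitrary: v)
    case 0
    have "\<epsilon> v \<in> \<eta> ` fpow (K 0) 1"
      using A.aug_in[OF 0] T1 by blast
    then obtain w where w: "w \<in> fpow (K 0) 1" "\<eta> w = \<epsilon> v" by (metis imageE)
    then have "f 0 v - w \<in> e 0 ` fpow (K 1) 0"
      unfolding B.exact_0 using f(2,3)[OF 0]
      by (auto simp: B.aug_simps intro: diff_in_fpow fpow_antimono)
    then have "f 0 v - w \<in> fpow (K 0) 1"
      using B.d_minimal by auto
    from add_in_fpow[OF this w(1)] show ?case by simp
  next
    case (Suc i)
    have "e i (f (Suc i) v) \<in> fpow (K i) (0 + 2)"
      using linear_map_fpow[OF f(1) A.finite_J Suc.IH A.d_minimal[OF Suc.prems]] f(4)[OF Suc.prems]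
      by (simp add: numeral_2_eq_2)
    then obtain w where w: "w \<in> fpow (K (Suc (Suc i))) (0 - 1)"
        "f (Suc i) v - e (Suc i) w \<in> fpow (K (Suc i)) (0 + 1)"
      using B.linear_part_acyclicD[OF ac f(2)[OF Suc.prems]] by blast
    then show ?case
      using add_in_fpow[OF w(2), of "e (Suc i) w"] B.d_minimal[of w] by simp
  qed
  then show thesis using that f by blast
qed


section \<open>The Koszul property in terms of representatives\<close>

lemma coset_eq_iff:
  assumes "module scale" and N: "module.subspace scale N"
  shows "v +o N = w +o N \<longleftrightarrow> v - w \<in> N"
proof -
  interpret module scale by fact
  have sub: "v +o N \<subseteq> w +o N" if "v - w \<in> N" for v w
  proof
    fix u assume "u \<in> v +o N"
    then have "(v - w) + (u - v) \<in> N"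
      using subspace_add[OF N that] set_plus_imp_minus by blast
    then have "u - w \<in> N" by simp
    then show "u \<in> w +o N"
      by (auto simp: elt_set_plus_def intro!: bexI[of _ "u - w"])
  qed
  show ?thesis
  proof
    assume "v +o N = w +o N"
    moreover have "v \<in> v +o N"
      using subspace_0[OF N] by (auto simp: elt_set_plus_def)
    ultimately have "v \<in> w +o N" by simp
    then show "v - w \<in> N" by (rule set_plus_imp_minus)
  next
    assume "v - w \<in> N"
    moreover from this have "w - v \<in> N"
      using subspace_neg[OF N, of "v - w"] by simp
    ultimately show "v +o N = w +o N" using sub by blast
  qed
qed

lemma induced_map_coset:
  assumes f: "module_hom s1 s2 f" and N: "f ` N \<subseteq> N'" "0 \<in> N" and N': "module.subspace s2 N'"
  shows "induced_map f N' (v +o N) = f v +o N'"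
proof -
  interpret f: module_hom s1 s2 f by fact
  show ?thesis
  proof (intro equalityI subsetI)
    fix u assume "u \<in> induced_map f N' (v +o N)"
    then obtain n n' where n: "n \<in> N" "n' \<in> N'" and u: "u = f (v + n) + n'"
      by (auto simp: induced_map_def elt_set_plus_def elim!: set_plus_elim)
    have "f n + n' \<in> N'"
      using f.m2.subspace_add[OF N'] n N(1) by blast
    then show "u \<in> f v +o N'"
      unfolding u f.add by (auto simp: elt_set_plus_def add.assoc)
  next
    fix u assume "u \<in> f v +o N'"
    then obtain n' where "n' \<in> N'" "u = f v + n'" by (auto simp: elt_set_plus_def)
    moreover have "v \<in> v +o N" using N(2) by (auto simp: elt_set_plus_def)
    ultimately show "u \<in> induced_map f N' (v +o N)"
      by (auto simp: induced_map_def)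
  qed
qed

lemma chain_module_eq: "chain_module F i = fpow {..<rank F i} 0"
  by (auto simp: chain_module_def fpow_def)

lemma lin_filtration_eq: "lin_filtration F p i = fpow {..<rank F i} (p - i)"
  by (simp add: lin_filtration_def max_ideal_power_eq free_scale_eq chain_module_eq ideal_smult_fpow)

lemma linear_differential: "linear_map (differential F i)"
  by (rule linear_mapI)
    (auto simp: differential_def fun_eq_iff sum.distrib sum_distrib_left distrib_right mult.assoc)

lemma linear_augmentation: "linear_form (augmentation F)"
  by (rule linear_formI)
    (auto simp: augmentation_def sum.distrib sum_distrib_left distrib_right mult.assoc)

lemma minimal_graded_free_resolution_imp:
  assumes "minimal_graded_free_resolution F M"
  shows "minimal_resolution (\<lambda>i. {..<rank F i}) (\<lambda>i. differential F (Suc i)) (augmentation F) M"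
proof (rule minimal_resolution.intro)
  show "finite {..<rank F i}" for i by simp
  show "linear_map (differential F (Suc i))" for i by (rule linear_differential)
  show "linear_form (augmentation F)" by (rule linear_augmentation)
  show "augmentation F ` fpow {..<rank F 0} 0 = M"
    using assms by (simp add: minimal_graded_free_resolution_def chain_module_eq)
  show "differential F (Suc 0) ` fpow {..<rank F 1} 0 =
      {v \<in> fpow {..<rank F 0} 0. augmentation F v = 0}"
    using assms by (simp add: minimal_graded_free_resolution_def chain_module_eq)
  show "differential F (Suc (Suc i)) ` fpow {..<rank F (Suc (Suc i))} 0 =
      {v \<in> fpow {..<rank F (Suc i)} 0. differential F (Suc i) v = 0}" for i
    using assms by (simp add: minimal_graded_free_resolution_def chain_module_eq)
  have "\<forall>i. differential F (Suc i) ` fpow {..<rank F (Suc i)} 0 \<subseteq> fpow {..<rank F i} 1"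
    using assms by (simp add: minimal_graded_free_resolution_def chain_module_eq free_scale_eq
        max_ideal_eq ideal_smult_fpow)
  then show "differential F (Suc i) v \<in> fpow {..<rank F i} 1" if "v \<in> fpow {..<rank F (Suc i)} 0" for v i
    using that by blast
qed

text \<open>Finitely supported families of cosets have finitely supported families of representatives.\<close>

lemma lin_module_iff: "c \<in> lin_module F i \<longleftrightarrow>
    (\<exists>v. (\<forall>p. v p \<in> lin_filtration F p i) \<and> finite {p. v p \<noteq> 0} \<and>
      c = (\<lambda>p. v p +o lin_filtration F (Suc p) i))"
proof
  assume c: "c \<in> lin_module F i"
  then have "\<forall>p. \<exists>v. v \<in> lin_filtration F p i \<and> c p = v +o lin_filtration F (Suc p) i"
    by (auto simp: lin_module_def quotient_module_def)
  then obtain v where v: "\<And>p. v p \<in> lin_filtration F p i"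
      "\<And>p. c p = v p +o lin_filtration F (Suc p) i"
    by metis
  define v' where "v' p = (if c p = lin_zero F i p then 0 else v p)" for p
  have "finite {p. v' p \<noteq> 0}"
    by (rule finite_subset[of _ "{p. c p \<noteq> lin_zero F i p}"])
      (use c in \<open>auto simp: v'_def lin_module_def\<close>)
  moreover have "v' p \<in> lin_filtration F p i" for p
    using v by (auto simp: v'_def lin_filtration_eq)
  moreover have "c = (\<lambda>p. v' p +o lin_filtration F (Suc p) i)"
  proof
    show "c p = v' p +o lin_filtration F (Suc p) i" for p
      using v(2)[of p] by (cases "c p = lin_zero F i p") (simp_all add: v'_def lin_zero_def)
  qed
  ultimately show "\<exists>v. (\<forall>p. v p \<in> lin_filtration F p i) \<and> finite {p. v p \<noteq> 0} \<and>
      c = (\<lambda>p. v p +o lin_filtration F (Suc p) i)"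
    by blast
next
  assume "\<exists>v. (\<forall>p. v p \<in> lin_filtration F p i) \<and> finite {p. v p \<noteq> 0} \<and>
      c = (\<lambda>p. v p +o lin_filtration F (Suc p) i)"
  then obtain v where v: "\<And>p. v p \<in> lin_filtration F p i" "finite {p. v p \<noteq> 0}"
      "c = (\<lambda>p. v p +o lin_filtration F (Suc p) i)"
    by blast
  have "finite {p. c p \<noteq> lin_zero F i p}"
    by (rule finite_subset[OF _ v(2)]) (auto simp: v(3) lin_zero_def)
  then show "c \<in> lin_module F i"
    using v(1) by (auto simp: lin_module_def v(3) quotient_module_def)
qed

text \<open>The homology of a direct sum of complexes is computed summand by summand.  The module in
  homological degree \<open>i\<close> of the summand \<open>p\<close> is \<open>\<mm>\<^bsup>p-i\<^esup> F\<close> modulo the next power,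
  so \<open>s = p - i\<close> is the order that matters; for \<open>p < i\<close> it is zero.\<close>

lemma lin_homology_nonzero_iff:
  assumes "minimal_graded_free_resolution F M"
  shows "\<not> lin_homology_nonzero F (Suc k) \<longleftrightarrow>
    (\<forall>s. \<forall>v\<in>fpow {..<rank F (Suc k)} s. differential F (Suc k) v \<in> fpow {..<rank F k} (s + 2) \<longrightarrow>
      (\<exists>w\<in>fpow {..<rank F (Suc (Suc k))} (s - 1).
         v - differential F (Suc (Suc k)) w \<in> fpow {..<rank F (Suc k)} (s + 1)))"
    (is "_ \<longleftrightarrow> ?acyclic")
proof -
  let ?L = "lin_filtration F" and ?D = "differential F"
  interpret minimal_resolution "\<lambda>i. {..<rank F i}" "\<lambda>i. ?D (Suc i)" "augmentation F" M
    by (rule minimal_graded_free_resolution_imp[OF assms])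
  have sub: "free_module.subspace (?L p i)" for p i
    by (simp add: lin_filtration_eq subspace_fpow)
  have D_L: "?D (Suc i) v \<in> ?L p i" if "v \<in> ?L p (Suc i)" for v p i
    using d_fpow[of v i "p - Suc i"] that
    by (auto simp: lin_filtration_eq intro: fpow_antimono)
  have diff: "lin_differential F (Suc i) (\<lambda>p. v p +o ?L (Suc p) (Suc i)) =
      (\<lambda>p. ?D (Suc i) (v p) +o ?L (Suc p) i)" for v i
    unfolding lin_differential_def
  proof
    fix p
    show "induced_map (?D (Suc i)) (?L (Suc p) (Suc i - 1)) (v p +o ?L (Suc p) (Suc i)) =
        ?D (Suc i) (v p) +o ?L (Suc p) i"
      using induced_map_coset[OF linear_differential, of F "Suc i" "?L (Suc p) (Suc i)" "?L (Suc p) i" "v p"]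
        D_L sub free_module.subspace_0[OF sub] by auto
  qed
  have zero_iff: "v +o ?L (Suc p) i = lin_zero F i p \<longleftrightarrow> v \<in> ?L (Suc p) i" for v p i
    using coset_eq_iff[OF free_module.module_axioms sub, of v "Suc p" i 0] by (simp add: lin_zero_def)
  let ?Z = "{c \<in> lin_module F (Suc k). lin_differential F (Suc k) c = lin_zero F (Suc k - 1)}"
  let ?B = "lin_differential F (Suc (Suc k)) ` lin_module F (Suc (Suc k))"
  have "?B \<subseteq> ?Z"
  proof
    fix c assume "c \<in> ?B"
    then obtain c' where c': "c' \<in> lin_module F (Suc (Suc k))" "c = lin_differential F (Suc (Suc k)) c'"
      by blast
    then obtain w where w: "\<And>p. w p \<in> ?L p (Suc (Suc k))" "finite {p. w p \<noteq> 0}"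
        and "c' = (\<lambda>p. w p +o ?L (Suc p) (Suc (Suc k)))"
      by (auto simp: lin_module_iff)
    then have w3: "c = (\<lambda>p. ?D (Suc (Suc k)) (w p) +o ?L (Suc p) (Suc k))"
      using c'(2) by (simp add: diff)
    have "finite {p. ?D (Suc (Suc k)) (w p) \<noteq> 0}"
      by (rule finite_subset[OF _ w(2)]) (auto simp: d_simps)
    then have "c \<in> lin_module F (Suc k)"
      using D_L[OF w(1)] unfolding lin_module_iff w3
      by (intro exI[of _ "\<lambda>p. ?D (Suc (Suc k)) (w p)"]) simp
    moreover have "?D (Suc k) (?D (Suc (Suc k)) (w p)) = 0" for p
      using d_d w(1)[of p] by (auto simp: lin_filtration_eq intro: fpow_antimono)
    then have "lin_differential F (Suc k) c = lin_zero F k"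
      by (simp add: w3 diff lin_zero_def)
    ultimately show "c \<in> ?Z" by simp
  qed
  then have "\<not> lin_homology_nonzero F (Suc k) \<longleftrightarrow> ?Z \<subseteq> ?B"
    unfolding lin_homology_nonzero_def by blast
  also have "\<dots> \<longleftrightarrow> ?acyclic"
  proof
    assume ZB: "?Z \<subseteq> ?B"
    show ?acyclic
    proof (intro allI ballI impI)
      fix s v assume v: "v \<in> fpow {..<rank F (Suc k)} s" "?D (Suc k) v \<in> fpow {..<rank F k} (s + 2)"
      \<comment> \<open>An element of \<open>\<mm>\<^sup>s F\<close> in homological degree \<open>i\<close> represents a class in the graded piece \<open>s + i\<close>.\<close>
      define p where "p = s + Suc k"
      define V where "V q = (if q = p then v else 0)" for q
      have "V q \<in> ?L q (Suc k)" "?D (Suc k) (V q) \<in> ?L (Suc q) k" for q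
        using v by (auto simp: V_def p_def lin_filtration_eq d_simps)
      moreover have "finite {q. V q \<noteq> 0}"
        by (rule finite_subset[of _ "{p}"]) (auto simp: V_def)
      ultimately have "(\<lambda>q. V q +o ?L (Suc q) (Suc k)) \<in> lin_module F (Suc k)"
        and "lin_differential F (Suc k) (\<lambda>q. V q +o ?L (Suc q) (Suc k)) = lin_zero F k"
        unfolding lin_module_iff diff by (blast, simp add: fun_eq_iff[of _ "lin_zero F k"] zero_iff)
      then have "(\<lambda>q. V q +o ?L (Suc q) (Suc k)) \<in> ?Z" by simp
      then obtain c' where c': "c' \<in> lin_module F (Suc (Suc k))"
          "(\<lambda>q. V q +o ?L (Suc q) (Suc k)) = lin_differential F (Suc (Suc k)) c'"
        using ZB by blast
      then obtain w where w: "\<And>p. w p \<in> ?L p (Suc (Suc k))"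
          and "c' = (\<lambda>p. w p +o ?L (Suc p) (Suc (Suc k)))"
        by (auto simp: lin_module_iff)
      then have w2: "(\<lambda>q. V q +o ?L (Suc q) (Suc k)) =
          (\<lambda>p. ?D (Suc (Suc k)) (w p) +o ?L (Suc p) (Suc k))"
        using c'(2) by (simp add: diff)
      have "V p - ?D (Suc (Suc k)) (w p) \<in> ?L (Suc p) (Suc k)"
        using fun_cong[OF w2, of p] by (simp add: coset_eq_iff[OF free_module.module_axioms sub])
      then show "\<exists>w\<in>fpow {..<rank F (Suc (Suc k))} (s - 1).
          v - ?D (Suc (Suc k)) w \<in> fpow {..<rank F (Suc k)} (s + 1)"
        using w[of p] by (intro bexI[of _ "w p"]) (simp_all add: V_def p_def lin_filtration_eq)
    qed
  next
    assume ac: ?acyclic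
    show "?Z \<subseteq> ?B"
    proof
      fix c assume c: "c \<in> ?Z"
      then obtain v where v: "\<And>p. v p \<in> ?L p (Suc k)" "finite {p. v p \<noteq> 0}"
          "c = (\<lambda>p. v p +o ?L (Suc p) (Suc k))"
        by (auto simp: lin_module_iff)
      have Dv: "?D (Suc k) (v p) \<in> ?L (Suc p) k" for p
        using c by (auto simp: v(3) diff fun_eq_iff zero_iff)
      have "\<exists>w. w \<in> ?L p (Suc (Suc k)) \<and> v p - ?D (Suc (Suc k)) w \<in> ?L (Suc p) (Suc k) \<and>
          (v p = 0 \<longrightarrow> w = 0)" for p
      proof (cases "v p = 0 \<or> p < Suc k")
        case True
        then show ?thesis
          using v(1)[of p] by (intro exI[of _ 0]) (auto simp: lin_filtration_eq d_simps)
      next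
        case False
        then obtain s where p: "p = s + Suc k"
          by (metis add.commute le_Suc_ex not_less)
        then show ?thesis
          using ac[rule_format, of "v p" s] v(1)[of p] Dv[of p] False
          by (auto simp: lin_filtration_eq)
      qed
      then obtain w where w: "\<And>p. w p \<in> ?L p (Suc (Suc k))"
          "\<And>p. v p - ?D (Suc (Suc k)) (w p) \<in> ?L (Suc p) (Suc k)" "\<And>p. v p = 0 \<Longrightarrow> w p = 0"
        by metis
      have "finite {p. w p \<noteq> 0}"
        by (rule finite_subset[OF _ v(2)]) (use w(3) in blast)
      then have "(\<lambda>p. w p +o ?L (Suc p) (Suc (Suc k))) \<in> lin_module F (Suc (Suc k))"
        using w(1) by (auto simp: lin_module_iff)
      moreover have "c = lin_differential F (Suc (Suc k)) (\<lambda>p. w p +o ?L (Suc p) (Suc (Suc k)))"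
        unfolding v(3) diff using w(2) by (intro ext) (simp only: coset_eq_iff[OF free_module.module_axioms sub])
      ultimately show "c \<in> ?B" by blast
    qed
  qed
  finally show ?thesis .
qed

text \<open>The linearity defect is defined by a chosen resolution, but by the comparison of resolutions
  every other minimal one, graded or not, decides the Koszul property as well.\<close>

lemma Koszul_iff_acyclic:
  assumes F: "\<exists>F. minimal_graded_free_resolution F M" and A: "minimal_resolution J d \<epsilon> M"
  shows "Koszul M \<longleftrightarrow> minimal_resolution.linear_part_acyclic J d"
proof -
  define F where "F = (SOME F. minimal_graded_free_resolution F M)"
  have F: "minimal_graded_free_resolution F M"
    unfolding F_def using F by (rule someI_ex)
  let ?J = "\<lambda>i. {..<rank F i}" and ?D = "\<lambda>i. differential F (Suc i)"
  interpret G: minimal_resolution ?J ?D "augmentation F" M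
    by (rule minimal_graded_free_resolution_imp[OF F])
  have "Koszul M \<longleftrightarrow> (\<forall>i. lin_homology_nonzero F i \<longrightarrow> i = 0)"
    by (auto simp: Koszul_def linearity_defect_def Let_def bot_enat_def enat_0_iff
        SUP_bot_conv[where 'a = enat, unfolded bot_enat_def] simp flip: F_def)
  also have "\<dots> \<longleftrightarrow> (\<forall>k. \<not> lin_homology_nonzero F (Suc k))"
    by (metis not0_implies_Suc old.nat.distinct(2))
  also have "\<dots> \<longleftrightarrow> G.linear_part_acyclic"
    unfolding G.linear_part_acyclic_def lin_homology_nonzero_iff[OF F] ..
  also have "\<dots> \<longleftrightarrow> minimal_resolution.linear_part_acyclic J d"
    using linear_part_acyclic_transfer[OF G.minimal_resolution_axioms A]
      linear_part_acyclic_transfer[OF A G.minimal_resolution_axioms] by blast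
  finally show ?thesis .
qed


section \<open>Submodules of free modules are finitely generated\<close>

text \<open>The combinatorial core of Dickson's lemma: below, the functions in \<open>G\<close> are the coordinates of
  a sequence of exponent vectors.\<close>

lemma mono_subsequence_finite:
  fixes G :: "(nat \<Rightarrow> nat) set"
  assumes "finite G"
  shows "\<exists>r::nat \<Rightarrow> nat. strict_mono r \<and> (\<forall>g\<in>G. mono (\<lambda>n. g (r n)))"
  using assms
proof (induction G)
  case empty
  show ?case by (intro exI[of _ id]) (simp add: strict_mono_def)
next
  case (insert g G)
  then obtain r :: "nat \<Rightarrow> nat" where r: "strict_mono r" "\<And>h. h \<in> G \<Longrightarrow> mono (\<lambda>n. h (r n))"
    by blast
  define P where "P m \<longleftrightarrow> (\<forall>k\<ge>m. g (r m) \<le> g (r k))" for m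
  have P: "\<exists>m\<ge>n. P m" for n
  proof -
    obtain m where "m \<ge> n" "\<And>k. k \<ge> n \<Longrightarrow> g (r m) \<le> g (r k)"
      using ex_has_least_nat[of "\<lambda>m. n \<le> m" n "\<lambda>m. g (r m)"] by auto
    then show ?thesis by (auto simp: P_def)
  qed
  obtain q where q: "\<And>n. P (q n)" "\<And>n. q n < q (Suc n)"
    using dependent_nat_choice[of "\<lambda>_. P" "\<lambda>_ m m'. m < m'"] P Suc_le_eq by metis
  have sq: "strict_mono q" using q(2) by (simp add: strict_mono_Suc_iff)
  have "mono (\<lambda>n. g (r (q n)))"
    using q(1) sq by (auto simp: mono_def P_def strict_mono_less_eq)
  moreover have "mono (\<lambda>n. h (r (q n)))" if "h \<in> G" for h
    using r(2)[OF that] sq by (auto simp: mono_def strict_mono_less_eq)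
  moreover have "strict_mono (\<lambda>n. r (q n))"
    using r(1) sq by (auto simp: strict_mono_def)
  ultimately show ?case by (intro exI[of _ "\<lambda>n. r (q n)"]) auto
qed

lemma dickson:
  fixes t :: "nat \<Rightarrow> ('x::finite \<Rightarrow>\<^sub>0 nat) \<times> nat"
  assumes "\<And>k. snd (t k) < n"
  obtains a b k where "a < b" "snd (t a) = snd (t b)" "fst (t b) = k + fst (t a)"
proof -
  \<comment> \<open>The position and its complement in \<open>n\<close> are both made monotone, so the position is constant.\<close>
  define G where "G = insert (\<lambda>k. snd (t k)) (insert (\<lambda>k. n - snd (t k))
    (range (\<lambda>i k. Poly_Mapping.lookup (fst (t k)) i)))"
  have "finite G" by (simp add: G_def)
  then obtain r :: "nat \<Rightarrow> nat" where r: "strict_mono r" "\<And>g. g \<in> G \<Longrightarrow> mono (\<lambda>n. g (r n))"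
    using mono_subsequence_finite by blast
  have le: "g (r 0) \<le> g (r 1)" if "g \<in> G" for g
    using r(2)[OF that] by (simp add: mono_def)
  have 1: "snd (t (r 0)) = snd (t (r 1))"
    using le[of "\<lambda>k. snd (t k)"] le[of "\<lambda>k. n - snd (t k)"] assms[of "r 0"] assms[of "r 1"]
    by (simp add: G_def)
  have "Poly_Mapping.lookup (fst (t (r 0))) i \<le> Poly_Mapping.lookup (fst (t (r 1))) i" for i
    using le[of "\<lambda>k. Poly_Mapping.lookup (fst (t k)) i"] by (simp add: G_def)
  then have "fst (t (r 1)) = (fst (t (r 1)) - fst (t (r 0))) + fst (t (r 0))"
    by (intro poly_mapping_eqI) (simp add: lookup_add lookup_minus)
  moreover have "r 0 < r 1" using r(1) by (simp add: strict_mono_def)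
  ultimately show thesis using that 1 by blast
qed

text \<open>A listing of the variables, which makes exponent vectors comparable lexicographically.\<close>

definition var_list :: "'x::finite list" where
  "var_list = (SOME xs. set xs = UNIV)"

lemma set_var_list: "set var_list = (UNIV :: 'x::finite set)"
  unfolding var_list_def by (rule someI_ex) (simp add: finite_list)

text \<open>A monomial order on the terms of a free module.  A term is a pair of an exponent vector and the
  position in which it occurs.\<close>

definition term_less :: "((('x::finite \<Rightarrow>\<^sub>0 nat) \<times> nat) \<times> (('x \<Rightarrow>\<^sub>0 nat) \<times> nat)) set" where
  "term_less = inv_image (lex less_than <*lex*> less_than)
     (\<lambda>(m, l). (map (Poly_Mapping.lookup m) var_list, l))"

lemma wf_term_less: "wf term_less"
  unfolding term_less_def by (intro wf_inv_image wf_lex_prod wf_lex wf_less_than)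

lemma trans_term_less: "trans term_less"
proof -
  have "trans (lex less_than)"
    using lexord_transI[OF trans_less_than] by (auto simp: trans_def lexord_lex)
  then show ?thesis
    unfolding term_less_def by (intro trans_inv_image trans_lex_prod trans_less_than)
qed

lemma term_less_total: "(s, t) \<in> term_less \<or> s = t \<or> (t, s) \<in> term_less"
proof -
  obtain m l m' l' where st: "s = (m, l)" "t = (m', l')" by fastforce
  let ?f = "\<lambda>m. map (Poly_Mapping.lookup m) var_list"
  have "(?f m, ?f m') \<in> lexord less_than \<or> ?f m = ?f m' \<or> (?f m', ?f m) \<in> lexord less_than"
    by (rule lexord_linear) auto
  then have "(?f m, ?f m') \<in> lex less_than \<or> ?f m = ?f m' \<or> (?f m', ?f m) \<in> lex less_than"
    by (simp only: lexord_lex length_map simp_thms)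
  moreover have "?f m = ?f m' \<longleftrightarrow> m = m'"
    by (auto simp: set_var_list poly_mapping_eq_iff fun_eq_iff)
  ultimately show ?thesis
    by (auto simp: st term_less_def)
qed

lemma lex_add:
  fixes f g h :: "'a \<Rightarrow> nat"
  assumes "(map f xs, map g xs) \<in> lex less_than"
  shows "(map (\<lambda>i. h i + f i) xs, map (\<lambda>i. h i + g i) xs) \<in> lex less_than"
  using assms by (induction xs) auto

lemma term_less_add:
  assumes "((m, l), (m', l')) \<in> term_less"
  shows "((k + m, l), (k + m', l')) \<in> term_less"
  using assms lex_add[of "Poly_Mapping.lookup m" var_list "Poly_Mapping.lookup m'" "Poly_Mapping.lookup k"]
  by (auto simp: term_less_def lookup_add set_var_list comp_def plus_poly_mapping.rep_eq)

definition vterms :: "nat \<Rightarrow> ('x::finite, 'k::field) vec \<Rightarrow> (('x \<Rightarrow>\<^sub>0 nat) \<times> nat) set" where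
  "vterms n v = {(m, l). l < n \<and> Poly_Mapping.lookup (v l) m \<noteq> 0}"

definition leads :: "nat \<Rightarrow> ('x::finite, 'k::field) vec \<Rightarrow> ('x \<Rightarrow>\<^sub>0 nat) \<times> nat \<Rightarrow> bool" where
  "leads n v t \<longleftrightarrow> t \<in> vterms n v \<and> (\<forall>t'\<in>vterms n v. t' = t \<or> (t', t) \<in> term_less)"

lemma finite_vterms: "finite (vterms n v)"
proof -
  have "vterms n v = (\<Union>l<n. (\<lambda>m. (m, l)) ` Poly_Mapping.keys (v l))"
    by (auto simp: vterms_def in_keys_iff)
  then show ?thesis by simp
qed

lemma leading_term_exists:
  fixes v :: "('x::finite, 'k::field) vec"
  assumes "v \<in> fpow {..<n} 0" "v \<noteq> 0"
  shows "\<exists>t. leads n v t"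
proof -
  have "\<exists>t\<in>X. \<forall>t'\<in>X. t' = t \<or> (t', t) \<in> term_less"
    if "finite X" "X \<noteq> {}" for X :: "(('x \<Rightarrow>\<^sub>0 nat) \<times> nat) set"
    using that
  proof (induction rule: finite_ne_induct)
    case (insert s X)
    then obtain t where t: "t \<in> X" "\<And>t'. t' \<in> X \<Longrightarrow> t' = t \<or> (t', t) \<in> term_less" by blast
    show ?case
    proof (cases "(t, s) \<in> term_less")
      case True
      then have "t' = s \<or> (t', s) \<in> term_less" if "t' \<in> insert s X" for t'
        using that t(2)[of t'] transD[OF trans_term_less] by blast
      then show ?thesis by blast
    next
      case False
      then have "s = t \<or> (s, t) \<in> term_less" using term_less_total by blast
      then show ?thesis using t by blast
    qed
  qed auto
  moreover obtain l m where "Poly_Mapping.lookup (v l) m \<noteq> 0"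
    using assms(2) by (auto simp: fun_eq_iff poly_mapping_eq_iff)
  then have "(m, l) \<in> vterms n v"
    using assms(1) by (auto simp: vterms_def fpow_def intro: leI)
  then have "vterms n v \<noteq> {}" by blast
  ultimately show ?thesis
    using finite_vterms[of n v] unfolding leads_def by blast
qed

lemma lookup_single_mult:
  fixes p :: "('x::finite, 'k::field) mpoly"
  shows "Poly_Mapping.lookup (Poly_Mapping.single k c * p) (k + m) = c * Poly_Mapping.lookup p m"
proof -
  have "Poly_Mapping.single k c * p =
      (\<Sum>n\<in>Poly_Mapping.keys p. Poly_Mapping.single (k + n) (c * Poly_Mapping.lookup p n))"
    by (subst (1) poly_mapping_sum_single) (simp add: sum_distrib_left mult_single)
  then show ?thesis
    by (simp add: lookup_sum lookup_single when_def in_keys_iff)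
qed

lemma lookup_single_mult_nonzero:
  assumes "Poly_Mapping.lookup (Poly_Mapping.single k c * p) m \<noteq> 0"
  obtains n where "m = k + n" "Poly_Mapping.lookup p n \<noteq> 0"
proof -
  have "m \<in> Poly_Mapping.keys (Poly_Mapping.single k c * p)"
    using assms by (simp add: in_keys_iff)
  then obtain n where "m = k + n" "n \<in> Poly_Mapping.keys p"
    using keys_mult[of "Poly_Mapping.single k c" p] by (auto split: if_splits)
  then show thesis using that by (simp add: in_keys_iff)
qed

text \<open>Hilbert's basis theorem, in the style of Groebner bases.  Otherwise, pick elements
  \<open>v 0\<close>, \<open>v 1\<close>, \<dots> of \<open>Z\<close>, each outside the span of its predecessors and with the smallest
  leading term that is then possible.  By Dickson's lemma some leading term divides a later one, and
  cancelling the later one contradicts its minimality.\<close>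

theorem finitely_generated_submodule:
  fixes Z :: "('x::finite, 'k::field) vec set"
  assumes Z: "free_module.subspace Z" "Z \<subseteq> fpow {..<n} 0"
  obtains B where "finite B" "B \<subseteq> Z" "free_module.span B = Z"
proof (rule ccontr)
  assume "\<not> thesis"
  with that have not_fg: "free_module.span B \<noteq> Z" if "finite B" "B \<subseteq> Z" for B
    using that by blast
  define best where "best B v t \<longleftrightarrow> v \<in> Z \<and> v \<notin> free_module.span B \<and> leads n v t \<and>
    (\<forall>v' t'. v' \<in> Z \<longrightarrow> v' \<notin> free_module.span B \<longrightarrow> leads n v' t' \<longrightarrow> (t', t) \<notin> term_less)" for B v t
  have ex_best: "\<exists>v t. best B v t" if B: "finite B" "B \<subseteq> Z" for B
  proof -
    have "free_module.span B \<subseteq> Z"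
      using free_module.span_minimal[OF B(2) Z(1)] .
    then obtain v where v: "v \<in> Z" "v \<notin> free_module.span B"
      using not_fg[OF B] by blast
    then have "v \<noteq> 0" using free_module.span_zero by metis
    then obtain t where "leads n v t"
      using leading_term_exists v(1) Z(2) by blast
    then have "t \<in> {t. \<exists>v\<in>Z. v \<notin> free_module.span B \<and> leads n v t}" using v by blast
    then obtain t' where "t' \<in> {t. \<exists>v\<in>Z. v \<notin> free_module.span B \<and> leads n v t}"
        and least: "\<And>s. (s, t') \<in> term_less \<Longrightarrow> s \<notin> {t. \<exists>v\<in>Z. v \<notin> free_module.span B \<and> leads n v t}"
      by (rule wfE_min[OF wf_term_less]) auto
    then obtain v' where "v' \<in> Z" "v' \<notin> free_module.span B" "leads n v' t'" by blast
    then have "best B v' t'"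
      unfolding best_def using least by blast
    then show ?thesis by blast
  qed
  define P where "P = (\<lambda>(B, v, t). finite B \<and> B \<subseteq> Z \<and> best B v t)"
  define Q :: "('x, 'k) vec set \<times> ('x, 'k) vec \<times> ('x \<Rightarrow>\<^sub>0 nat) \<times> nat \<Rightarrow>
      ('x, 'k) vec set \<times> ('x, 'k) vec \<times> ('x \<Rightarrow>\<^sub>0 nat) \<times> nat \<Rightarrow> bool"
    where "Q = (\<lambda>(B, v, t) (B', v', t'). B' = insert v B)"
  have "\<exists>f. \<forall>k::nat. P (f k) \<and> Q (f k) (f (Suc k))"
  proof (rule dependent_nat_choice)
    show "\<exists>S. P S" using ex_best[of "{}"] by (auto simp: P_def)
  next
    fix S assume "P S"
    moreover obtain B v t where S: "S = (B, v, t)" by (metis prod_cases3)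
    ultimately have "finite (insert v B)" "insert v B \<subseteq> Z" by (auto simp: P_def best_def)
    then obtain v' t' where "best (insert v B) v' t'" using ex_best by blast
    then have "P (insert v B, v', t') \<and> Q S (insert v B, v', t')"
      using \<open>finite (insert v B)\<close> \<open>insert v B \<subseteq> Z\<close> by (simp add: P_def Q_def S)
    then show "\<exists>S'. P S' \<and> Q S S'" by blast
  qed
  then obtain f where f: "\<And>k. P (f k)" "\<And>k. Q (f k) (f (Suc k))" by blast
  define B v t where "B k = fst (f k)" and "v k = fst (snd (f k))" and "t k = snd (snd (f k))" for k
  have best: "best (B k) (v k) (t k)" for k
    using f(1)[of k] by (simp add: P_def B_def v_def t_def split: prod.splits)
  have B_Suc: "B (Suc k) = insert (v k) (B k)" for k
    using f(2)[of k] by (simp add: Q_def B_def v_def split: prod.splits)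
  have v_in_B: "v a \<in> B b" if "a < b" for a b
    using that by (induction b) (auto simp: B_Suc less_Suc_eq)
  have "snd (t k) < n" for k
    using best[of k] by (auto simp: best_def leads_def vterms_def)
  then obtain a b k where ab: "a < b" "snd (t a) = snd (t b)" "fst (t b) = k + fst (t a)"
    by (rule dickson)
  obtain m l where ta: "t a = (m, l)" by fastforce
  have tb: "t b = (k + m, l)" using ab ta by (metis fst_conv prod.collapse snd_conv)
  have la: "leads n (v a) (m, l)" and lb: "leads n (v b) (k + m, l)"
    using best[of a] best[of b] by (simp_all add: best_def ta tb)
  define c where "c = Poly_Mapping.lookup (v b l) (k + m) / Poly_Mapping.lookup (v a l) m"
  \<comment> \<open>Subtract the multiple of \<open>v a\<close> that cancels the leading term of \<open>v b\<close>.\<close>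
  define u where "u = v b - smul (Poly_Mapping.single k c) (v a)"
  have uZ: "u \<in> Z"
    using best[of a] best[of b] free_module.subspace_diff[OF Z(1)] free_module.subspace_scale[OF Z(1)]
    by (simp add: u_def best_def)
  have us: "u \<notin> free_module.span (B b)"
  proof
    assume "u \<in> free_module.span (B b)"
    moreover have "smul (Poly_Mapping.single k c) (v a) \<in> free_module.span (B b)"
      by (intro free_module.span_scale free_module.span_base v_in_B ab(1))
    ultimately have "u + smul (Poly_Mapping.single k c) (v a) \<in> free_module.span (B b)"
      by (rule free_module.span_add)
    then show False using best[of b] by (simp add: u_def best_def)
  qed
  then have "u \<noteq> 0" using free_module.span_zero by metis
  then obtain s where s: "leads n u s"
    using leading_term_exists uZ Z(2) by blast
  obtain m' l' where s': "s = (m', l')" by fastforce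
  have in_u: "l' < n" "Poly_Mapping.lookup (u l') m' \<noteq> 0"
    using s by (auto simp: leads_def vterms_def s')
  have u_lookup: "Poly_Mapping.lookup (u l') m' = Poly_Mapping.lookup (v b l') m' -
      Poly_Mapping.lookup (Poly_Mapping.single k c * v a l') m'"
    by (simp add: u_def lookup_minus)
  have "(m', l') \<noteq> (k + m, l)"
  proof
    assume "(m', l') = (k + m, l)"
    moreover have "Poly_Mapping.lookup (v a l) m \<noteq> 0"
      using la by (simp add: leads_def vterms_def)
    ultimately have "Poly_Mapping.lookup (u l') m' = 0"
      unfolding u_lookup by (simp add: lookup_single_mult c_def)
    then show False using in_u(2) by simp
  qed
  moreover have "(m', l') = (k + m, l) \<or> ((m', l'), (k + m, l)) \<in> term_less"
  proof (cases "Poly_Mapping.lookup (v b l') m' = 0")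
    case False
    then have "(m', l') \<in> vterms n (v b)" using in_u(1) by (simp add: vterms_def)
    then show ?thesis using lb unfolding leads_def by blast
  next
    case True
    then have "Poly_Mapping.lookup (Poly_Mapping.single k c * v a l') m' \<noteq> 0"
      using in_u(2) by (simp add: u_lookup)
    then obtain q where q: "m' = k + q" "Poly_Mapping.lookup (v a l') q \<noteq> 0"
      by (rule lookup_single_mult_nonzero)
    then have "(q, l') \<in> vterms n (v a)" using in_u(1) by (simp add: vterms_def)
    then have "(q, l') = (m, l) \<or> ((q, l'), (m, l)) \<in> term_less"
      using la unfolding leads_def by blast
    then show ?thesis using term_less_add q(1) by blast
  qed
  ultimately have "(s, t b) \<in> term_less" unfolding s' tb by blast
  then show False
    using best[of b] uZ us s unfolding best_def by blast
qed


section \<open>Existence of minimal graded resolutions\<close>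

definition homogeneous_component :: "int \<Rightarrow> ('x::finite, 'k::field) mpoly \<Rightarrow> ('x, 'k) mpoly" where
  "homogeneous_component d f = (\<Sum>m\<in>Poly_Mapping.keys f.
     if int (mono_degree m) = d then Poly_Mapping.single m (Poly_Mapping.lookup f m) else 0)"

lemma lookup_homogeneous_component:
  "Poly_Mapping.lookup (homogeneous_component d f) m = (if int (mono_degree m) = d then Poly_Mapping.lookup f m else 0)"
proof -
  have "Poly_Mapping.lookup (homogeneous_component d f) m = (\<Sum>n\<in>Poly_Mapping.keys f.
      if n = m then (if int (mono_degree m) = d then Poly_Mapping.lookup f m else 0) else 0)"
    unfolding homogeneous_component_def lookup_sum by (rule sum.cong) (auto simp: lookup_single when_def)
  then show ?thesis by (simp add: in_keys_iff)
qed

lemma homogeneous_component_zero [simp]: "homogeneous_component d 0 = 0"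
  by (simp add: homogeneous_component_def)

lemma homogeneous_component_add: "homogeneous_component d (f + g) = homogeneous_component d f + homogeneous_component d g"
  by (rule poly_mapping_eqI) (simp add: lookup_homogeneous_component lookup_add)

lemma homogeneous_component_sum: "homogeneous_component d (\<Sum>i\<in>A. f i) = (\<Sum>i\<in>A. homogeneous_component d (f i))"
  by (induction A rule: infinite_finite_induct) (simp_all add: homogeneous_component_add)

lemma homogeneous_homogeneous_component: "homogeneous d (homogeneous_component d f)"
  by (auto simp: homogeneous_def in_keys_iff lookup_homogeneous_component split: if_splits)

lemma homogeneous_component_homogeneous: "homogeneous e f \<Longrightarrow> homogeneous_component d f = (if d = e then f else 0)"
  by (rule poly_mapping_eqI) (auto simp: homogeneous_def lookup_homogeneous_component in_keys_iff)

lemma homogeneous_mult: "homogeneous d f \<Longrightarrow> homogeneous e g \<Longrightarrow> homogeneous (d + e) (f * g)"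
  using keys_mult[of f g] by (fastforce simp: homogeneous_def mono_degree_add)

lemma homogeneous_single: "homogeneous (int (mono_degree m)) (Poly_Mapping.single m c)"
  by (simp add: homogeneous_def)

lemma homogeneous_component_mult:
  assumes g: "homogeneous e g"
  shows "homogeneous_component d (f * g) = homogeneous_component (d - e) f * g"
proof -
  have "homogeneous_component d (Poly_Mapping.single m c * g) = homogeneous_component (d - e) (Poly_Mapping.single m c) * g" for m c
    using homogeneous_component_homogeneous[OF homogeneous_mult[OF homogeneous_single[of m c] g], of d]
      homogeneous_component_homogeneous[OF homogeneous_single[of m c], of "d - e"] by auto
  then have "homogeneous_component d ((\<Sum>m\<in>A. Poly_Mapping.single m (c m)) * g) =
      homogeneous_component (d - e) (\<Sum>m\<in>A. Poly_Mapping.single m (c m)) * g" for A c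
    by (simp add: sum_distrib_right homogeneous_component_sum)
  from this[where A = "Poly_Mapping.keys f" and c = "Poly_Mapping.lookup f"] show ?thesis
    by (simp flip: poly_mapping_sum_single)
qed

text \<open>In the following \<open>s l\<close> is the degree of the basis vector in position \<open>l\<close>.\<close>

definition vhomogeneous :: "(nat \<Rightarrow> int) \<Rightarrow> int \<Rightarrow> ('x::finite, 'k::field) vec \<Rightarrow> bool" where
  "vhomogeneous s d v \<longleftrightarrow> (\<forall>l. homogeneous (d - s l) (v l))"

definition vector_component :: "(nat \<Rightarrow> int) \<Rightarrow> int \<Rightarrow> ('x::finite, 'k::field) vec \<Rightarrow> ('x, 'k) vec" where
  "vector_component s d v = (\<lambda>l. homogeneous_component (d - s l) (v l))"

definition graded_submodule :: "nat \<Rightarrow> (nat \<Rightarrow> int) \<Rightarrow> ('x::finite, 'k::field) vec set \<Rightarrow> bool" where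
  "graded_submodule n s Z \<longleftrightarrow> free_module.subspace Z \<and> Z \<subseteq> fpow {..<n} 0 \<and>
     (\<forall>d. \<forall>v\<in>Z. vector_component s d v \<in> Z)"

definition lin_comb ::
  "nat \<Rightarrow> (nat \<Rightarrow> ('x::finite, 'k::field) vec) \<Rightarrow> ('x, 'k) vec \<Rightarrow> ('x, 'k) vec" where
  "lin_comb r E a = (\<Sum>j<r. smul (a j) (E j))"

lemma linear_lin_comb: "linear_map (lin_comb r E)"
  by (rule linear_mapI) (simp_all add: lin_comb_def fun_eq_iff sum_fun_apply sum_distrib_left
    sum.distrib distrib_right mult.assoc)

lemma vhomogeneous_vector_component: "vhomogeneous s d (vector_component s d v)"
  by (simp add: vhomogeneous_def vector_component_def homogeneous_homogeneous_component)

lemma vector_component_decomposition: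
  assumes "v \<in> fpow {..<n} 0"
  obtains D where "finite D" "v = (\<Sum>d\<in>D. vector_component s d v)"
proof
  define D where "D = (\<Union>l<n. (\<lambda>m. int (mono_degree m) + s l) ` Poly_Mapping.keys (v l))"
  show fin: "finite D" by (simp add: D_def)
  show "v = (\<Sum>d\<in>D. vector_component s d v)"
  proof (intro ext poly_mapping_eqI)
    fix l m
    have "Poly_Mapping.lookup ((\<Sum>d\<in>D. vector_component s d v) l) m =
        (\<Sum>d\<in>D. if d = int (mono_degree m) + s l then Poly_Mapping.lookup (v l) m else 0)"
      unfolding sum_fun_apply lookup_sum vector_component_def lookup_homogeneous_component by (rule sum.cong) auto
    also have "\<dots> = Poly_Mapping.lookup (v l) m"
    proof (cases "Poly_Mapping.lookup (v l) m = 0")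
      case False
      then have "l < n" using assms by (auto simp: fpow_def intro: leI)
      then have "int (mono_degree m) + s l \<in> D"
        using False unfolding D_def by (intro UN_I[of l] imageI) (simp_all add: in_keys_iff)
      then show ?thesis using fin by simp
    qed (simp cong: if_cong)
    finally show "Poly_Mapping.lookup (v l) m = Poly_Mapping.lookup ((\<Sum>d\<in>D. vector_component s d v) l) m" by simp
  qed
qed

lemma vector_component_lin_comb:
  assumes "\<And>j. j < r \<Longrightarrow> vhomogeneous s (sh j) (E j)"
  shows "vector_component s d (lin_comb r E a) = lin_comb r E (vector_component sh d a)"
proof
  fix l
  have "homogeneous_component (d - s l) (a j * E j l) = homogeneous_component (d - sh j) (a j) * E j l" if "j < r" for j
    using homogeneous_component_mult[of "sh j - s l" "E j l" "d - s l" "a j"] assms[OF that]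
    by (simp add: vhomogeneous_def)
  then show "vector_component s d (lin_comb r E a) l = lin_comb r E (vector_component sh d a) l"
    by (simp add: vector_component_def lin_comb_def sum_fun_apply homogeneous_component_sum)
qed

definition minimal_generators :: "nat \<Rightarrow> (nat \<Rightarrow> int) \<Rightarrow> ('x::finite, 'k::field) vec set \<Rightarrow>
    nat \<Rightarrow> (nat \<Rightarrow> int) \<Rightarrow> (nat \<Rightarrow> ('x, 'k) vec) \<Rightarrow> bool" where
  "minimal_generators n s Z r sh E \<longleftrightarrow>
     (\<forall>j<r. E j \<in> fpow {..<n} 0 \<and> vhomogeneous s (sh j) (E j)) \<and>
     lin_comb r E ` fpow {..<r} 0 = Z \<and>
     (\<forall>a\<in>fpow {..<r} 0. lin_comb r E a = 0 \<longrightarrow> a \<in> fpow {..<r} 1)"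

lemma homogeneous_finite_generators:
  assumes Z: "graded_submodule n s Z"
  obtains B where "finite B" "B \<subseteq> {v\<in>Z. \<exists>d. vhomogeneous s d v}" "free_module.span B = Z"
proof -
  let ?H = "{v\<in>Z. \<exists>d. vhomogeneous s d v}"
  have sub: "free_module.subspace Z" "Z \<subseteq> fpow {..<n} 0" and comp: "\<And>d v. v \<in> Z \<Longrightarrow> vector_component s d v \<in> Z"
    using Z by (auto simp: graded_submodule_def)
  obtain C where C: "finite C" "C \<subseteq> Z" "free_module.span C = Z"
    using finitely_generated_submodule[OF sub] .
  have "\<forall>v\<in>C. \<exists>B. finite B \<and> B \<subseteq> ?H \<and> v \<in> free_module.span B"
  proof
    fix v assume v: "v \<in> C"
    then have "v \<in> fpow {..<n} 0" using C(2) sub(2) by blast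
    then obtain D where D: "finite D" "v = (\<Sum>d\<in>D. vector_component s d v)"
      by (rule vector_component_decomposition)
    have "(\<Sum>d\<in>D. vector_component s d v) \<in> free_module.span ((\<lambda>d. vector_component s d v) ` D)"
      by (intro free_module.span_sum free_module.span_base) blast
    then have "v \<in> free_module.span ((\<lambda>d. vector_component s d v) ` D)"
      by (simp flip: D(2))
    moreover have "(\<lambda>d. vector_component s d v) ` D \<subseteq> ?H"
      using comp v C(2) vhomogeneous_vector_component by blast
    ultimately show "\<exists>B. finite B \<and> B \<subseteq> ?H \<and> v \<in> free_module.span B" using D(1) by blast
  qed
  from bchoice[OF this] obtain b
    where b: "\<forall>v\<in>C. finite (b v) \<and> b v \<subseteq> ?H \<and> v \<in> free_module.span (b v)"
    by blast
  show thesis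
  proof
    show "finite (\<Union>(b ` C))" "\<Union>(b ` C) \<subseteq> ?H" using b C(1) by auto
    have "C \<subseteq> free_module.span (\<Union>(b ` C))"
      using b free_module.span_mono[OF UN_upper[of _ C b]] by blast
    then have "Z \<subseteq> free_module.span (\<Union>(b ` C))"
      unfolding C(3)[symmetric] by (rule free_module.span_minimal) (rule free_module.subspace_span)
    moreover have "\<Union>(b ` C) \<subseteq> Z" using b by blast
    then have "free_module.span (\<Union>(b ` C)) \<subseteq> Z"
      by (rule free_module.span_minimal[OF _ sub(1)])
    ultimately show "free_module.span (\<Union>(b ` C)) = Z" by (rule equalityI[rotated])
  qed
qed

text \<open>A generating set of homogeneous elements of least cardinality is minimal: if some relation had a
  coefficient with a nonzero constant term, its component in the degree of the corresponding generator
  would express that generator by the others.\<close>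

lemma minimal_generators_exist:
  fixes Z :: "('x::finite, 'k::field) vec set"
  assumes Z: "graded_submodule n s Z"
  shows "\<exists>r sh E. minimal_generators n s Z r sh E"
proof -
  let ?H = "{v\<in>Z. \<exists>d. vhomogeneous s d v}"
  define good where "good B \<longleftrightarrow> finite B \<and> B \<subseteq> ?H \<and> free_module.span B = Z" for B
  obtain B0 where "finite B0" "B0 \<subseteq> ?H" "free_module.span B0 = Z"
    by (rule homogeneous_finite_generators[OF Z])
  then have "good B0" unfolding good_def by (intro conjI)
  from ex_has_least_nat[of good, OF this, of card] obtain B
    where B: "good B" and "\<forall>C. good C \<longrightarrow> card B \<le> card C"
    by (elim exE conjE)
  then have least: "card B \<le> card C" if "good C" for C using that by simp
  have fin: "finite B" and BH: "B \<subseteq> ?H" and span: "free_module.span B = Z"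
    using B by (auto simp: good_def)
  define r where "r = card B"
  obtain E where E: "bij_betw E {..<r} B"
    using ex_bij_betw_nat_finite[OF fin] by (auto simp: r_def atLeast0LessThan)
  have EB: "E j \<in> B" if "j < r" for j
    using E that by (auto simp: bij_betw_def)
  then have "\<exists>d. vhomogeneous s d (E j)" if "j < r" for j
    using that BH by blast
  then obtain sh where sh: "\<And>j. j < r \<Longrightarrow> vhomogeneous s (sh j) (E j)" by metis
  have sub: "Z \<subseteq> fpow {..<n} 0" using Z by (simp add: graded_submodule_def)
  have "lin_comb r E ` fpow {..<r} 0 = Z"
  proof (intro equalityI subsetI)
    fix z assume "z \<in> lin_comb r E ` fpow {..<r} 0"
    then obtain a where z: "z = lin_comb r E a" by blast
    show "z \<in> Z"
      unfolding z lin_comb_def span[symmetric]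
      by (intro free_module.span_sum free_module.span_scale free_module.span_base EB) simp
  next
    fix z assume "z \<in> Z"
    then obtain u where u: "z = (\<Sum>v\<in>B. smul (u v) v)"
      unfolding span[symmetric] free_module.span_finite[OF fin] by blast
    also have "\<dots> = (\<Sum>j<r. smul (u (E j)) (E j))"
      by (rule sum.reindex_bij_betw[OF E, symmetric])
    also have "\<dots> = lin_comb r E (\<lambda>j. if j < r then u (E j) else 0)"
      by (simp add: lin_comb_def)
    finally have "z = lin_comb r E (\<lambda>j. if j < r then u (E j) else 0)" .
    moreover have "(\<lambda>j. if j < r then u (E j) else 0) \<in> fpow {..<r} 0"
      by (simp add: fpow_def)
    ultimately show "z \<in> lin_comb r E ` fpow {..<r} 0" by (rule image_eqI)
  qed
  moreover have "a \<in> fpow {..<r} 1" if a: "a \<in> fpow {..<r} 0" "lin_comb r E a = 0" for a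
  proof (rule fpowI)
    fix j assume "j \<in> {..<r}"
    then have j: "j < r" by simp
    show "a j \<in> mpow 1"
    proof (rule ccontr)
      assume "a j \<notin> mpow 1"
      define c where "c = Poly_Mapping.lookup (a j) 0"
      have "c \<noteq> 0" using \<open>a j \<notin> mpow 1\<close> unfolding c_def mpow_1_iff .
      \<comment> \<open>The component of the relation in the degree of \<open>E j\<close> has the constant \<open>c\<close> as coefficient of \<open>E j\<close>.\<close>
      define b where "b = vector_component sh (sh j) a"
      have "lin_comb r E b = vector_component s (sh j) 0"
        using vector_component_lin_comb[of r s sh E "sh j" a, OF sh] a(2) by (simp add: b_def)
      also have "\<dots> = 0" by (simp add: vector_component_def fun_eq_iff)
      finally have "smul (b j) (E j) + (\<Sum>i\<in>{..<r} - {j}. smul (b i) (E i)) = 0"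
        unfolding lin_comb_def using j by (subst (asm) sum.remove[of _ j]) auto
      then have "smul (b j) (E j) = - (\<Sum>i\<in>{..<r} - {j}. smul (b i) (E i))"
        by (simp add: eq_neg_iff_add_eq_0)
      also have "\<dots> \<in> free_module.span (B - {E j})"
      proof (intro free_module.span_neg free_module.span_sum free_module.span_scale free_module.span_base)
        fix i assume "i \<in> {..<r} - {j}"
        then show "E i \<in> B - {E j}"
          using EB E j by (auto simp: bij_betw_def inj_on_def)
      qed
      finally have "smul (Poly_Mapping.single 0 (1 / c)) (smul (b j) (E j)) \<in> free_module.span (B - {E j})"
        by (rule free_module.span_scale)
      moreover have "b j = Poly_Mapping.single 0 c"
        by (rule poly_mapping_eqI)
          (auto simp: b_def vector_component_def lookup_homogeneous_component lookup_single when_def c_def mono_degree_eq_0_iff)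
      ultimately have "E j \<in> free_module.span (B - {E j})"
        using \<open>c \<noteq> 0\<close> by (simp add: mult_single)
      then have "B \<subseteq> free_module.span (B - {E j})"
        using free_module.span_superset[of "B - {E j}"] by blast
      then have "free_module.span (B - {E j}) = Z"
        unfolding span[symmetric] using free_module.span_minimal[OF _ free_module.subspace_span]
          free_module.span_mono[of "B - {E j}" B] by blast
      then have "good (B - {E j})"
        using fin BH by (auto simp: good_def)
      then have "card B \<le> card (B - {E j})" by (rule least)
      then show False
        using card_Diff1_less[OF fin EB[OF j]] by simp
    qed
  qed (use a in \<open>simp add: fpow_def\<close>)
  ultimately have "minimal_generators n s Z r sh E"
    using EB BH sub sh unfolding minimal_generators_def by blast
  then show ?thesis by blast
qed

lemma graded_syzygies:
  assumes "\<And>j. j < r \<Longrightarrow> vhomogeneous s (sh j) (E j)"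
  shows "graded_submodule r sh {a \<in> fpow {..<r} 0. lin_comb r E a = 0}"
  unfolding graded_submodule_def
proof (intro conjI allI ballI)
  show "free_module.subspace {a \<in> fpow {..<r} 0. lin_comb r E a = 0}"
    by (simp add: free_module.subspace_def add_in_fpow smul_in_fpow
        module_hom.add[OF linear_lin_comb] module_hom.scale[OF linear_lin_comb]
        module_hom.zero[OF linear_lin_comb])
  fix d a assume a: "a \<in> {a \<in> fpow {..<r} 0. lin_comb r E a = 0}"
  then have "lin_comb r E (vector_component sh d a) = vector_component s d 0"
    using vector_component_lin_comb[of r s sh E d a, OF assms] by simp
  also have "\<dots> = 0" by (simp add: vector_component_def fun_eq_iff)
  finally show "vector_component sh d a \<in> {a \<in> fpow {..<r} 0. lin_comb r E a = 0}"
    using a by (auto simp: fpow_def vector_component_def)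
qed auto

definition graded_ideal :: "('x::finite, 'k::field) mpoly set \<Rightarrow> bool" where
  "graded_ideal M \<longleftrightarrow> ring_module.subspace M \<and> (\<forall>d. \<forall>f\<in>M. homogeneous_component d f \<in> M)"

lemma homogeneous_ideal_imp_graded:
  assumes "homogeneous_ideal M"
  shows "graded_ideal M"
proof -
  obtain G where G: "\<And>g. g \<in> G \<Longrightarrow> \<exists>d. homogeneous d g" and M: "M = ring_module.span G"
    using assms by (auto simp: homogeneous_ideal_def)
  have "homogeneous_component d f \<in> M" if "f \<in> M" for d f
    using that unfolding M
  proof (induction rule: ring_module.span_induct_alt)
    case base
    show ?case by (simp add: ring_module.span_zero)
  next
    case (step c g f)
    obtain e where "homogeneous e g" using G[OF step(1)] by blast
    then have "homogeneous_component d (c * g + f) = homogeneous_component (d - e) c * g + homogeneous_component d f"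
      by (simp add: homogeneous_component_add homogeneous_component_mult)
    then show ?case
      using step by (auto intro: ring_module.span_add ring_module.span_scale ring_module.span_base)
  qed
  then show ?thesis by (simp add: graded_ideal_def M)
qed

text \<open>Iterate the choice of minimal generators, each time for the syzygies of the previous generators,
  which form a graded submodule.  A state of the recursion holds the number of generators, their degrees,
  and the generators as columns; the ideal itself is the submodule \<open>Z0\<close> of a free module of rank
  \<open>1\<close>.\<close>

theorem minimal_graded_free_resolution_exists:
  fixes M :: "('x::finite, 'k::field) mpoly set"
  assumes M: "graded_ideal M"
  shows "\<exists>F. minimal_graded_free_resolution F M"
proof -
  define Z0 :: "('x, 'k) vec set" where "Z0 = {v \<in> fpow {..<1} 0. v 0 \<in> M}"
  have Z0: "graded_submodule 1 (\<lambda>_. 0) Z0"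
    using M ring_module.subspace_def
    by (auto simp: graded_submodule_def Z0_def free_module.subspace_def graded_ideal_def vector_component_def
        ring_module.subspace_def fpow_def)
  let ?syz = "\<lambda>r (E :: nat \<Rightarrow> ('x, 'k) vec). {a \<in> fpow {..<r} 0. lin_comb r E a = 0}"
  define P :: "nat \<Rightarrow> nat \<times> (nat \<Rightarrow> int) \<times> (nat \<Rightarrow> ('x, 'k) vec) \<Rightarrow> bool" where
    "P = (\<lambda>k (r, sh, E). (\<exists>n s Z. minimal_generators n s Z r sh E) \<and>
       (k = 0 \<longrightarrow> minimal_generators 1 (\<lambda>_. 0) Z0 r sh E))"
  define Q :: "nat \<Rightarrow> nat \<times> (nat \<Rightarrow> int) \<times> (nat \<Rightarrow> ('x, 'k) vec) \<Rightarrow>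
      nat \<times> (nat \<Rightarrow> int) \<times> (nat \<Rightarrow> ('x, 'k) vec) \<Rightarrow> bool" where
    "Q = (\<lambda>_ (r, sh, E) (r', sh', E'). minimal_generators r sh (?syz r E) r' sh' E')"
  have "\<exists>S. \<forall>k. P k (S k) \<and> Q k (S k) (S (Suc k))"
  proof (rule dependent_nat_choice)
    obtain r sh E where "minimal_generators 1 (\<lambda>_. 0) Z0 r sh E"
      using minimal_generators_exist[OF Z0] by (elim exE)
    then have "P 0 (r, sh, E)" unfolding P_def by blast
    then show "\<exists>S. P 0 S" by (rule exI)
  next
    fix S k assume PS: "P k S"
    obtain r sh E where S: "S = (r, sh, E)" by (metis prod_cases3)
    obtain n s Z where "minimal_generators n s Z r sh E" using PS by (auto simp: P_def S)
    then have "graded_submodule r sh (?syz r E)"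
      by (intro graded_syzygies) (auto simp: minimal_generators_def)
    then obtain r' sh' E' where "minimal_generators r sh (?syz r E) r' sh' E'"
      using minimal_generators_exist by blast
    then have "P (Suc k) (r', sh', E') \<and> Q k S (r', sh', E')"
      unfolding P_def Q_def S by blast
    then show "\<exists>S'. P (Suc k) S' \<and> Q k S S'" by (rule exI)
  qed
  then obtain S where S: "\<And>k. P k (S k)" "\<And>k. Q k (S k) (S (Suc k))" by blast
  define r sh E where "r k = fst (S k)" and "sh k = fst (snd (S k))" and "E k = snd (snd (S k))" for k
  have gen_0: "minimal_generators 1 (\<lambda>_. 0) Z0 (r 0) (sh 0) (E 0)"
    using S(1)[of 0] by (simp add: P_def r_def sh_def E_def split: prod.splits)
  have gen_Suc: "minimal_generators (r k) (sh k) (?syz (r k) (E k)) (r (Suc k)) (sh (Suc k)) (E (Suc k))" for k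
    using S(2)[of k] by (simp add: Q_def r_def sh_def E_def split: prod.splits)
  have minimal: "?syz (r k) (E k) \<subseteq> fpow {..<r k} 1" for k
    using gen_0 gen_Suc by (cases k) (auto simp: minimal_generators_def)
  define F :: "('x, 'k) free_complex" where
    "F = \<lparr>rank = r, shift = sh, entry = (\<lambda>i l j. E i j l), gen = (\<lambda>j. E 0 j 0)\<rparr>"
  have F: "rank F = r" "shift F = sh" "\<And>i l j. entry F i l j = E i j l" "\<And>j. gen F j = E 0 j 0"
    by (simp_all add: F_def)
  have diff: "differential F (Suc i) = lin_comb (r (Suc i)) (E (Suc i))" for i
  proof (intro ext)
    fix v l
    have "E (Suc i) j l = 0" if "j < r (Suc i)" "\<not> l < r i" for j
      using gen_Suc[of i] that by (auto simp: minimal_generators_def fpow_def)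
    then show "differential F (Suc i) v l = lin_comb (r (Suc i)) (E (Suc i)) v l"
      by (auto simp: differential_def lin_comb_def sum_fun_apply F)
  qed
  have aug: "augmentation F v = lin_comb (r 0) (E 0) v 0" for v
    by (simp add: augmentation_def lin_comb_def sum_fun_apply F)
  have comb_0: "lin_comb (r 0) (E 0) v \<in> fpow {..<1} 0" for v
    unfolding lin_comb_def using gen_0
    by (intro sum_in_fpow smul_in_fpow) (simp add: minimal_generators_def)
  have aug_zero: "augmentation F v = 0 \<longleftrightarrow> lin_comb (r 0) (E 0) v = 0" for v
  proof
    assume "augmentation F v = 0"
    then have "lin_comb (r 0) (E 0) v l = 0" for l
      using comb_0[of v] by (cases l) (simp_all add: aug fpow_def)
    then show "lin_comb (r 0) (E 0) v = 0" by (simp add: fun_eq_iff)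
  qed (simp add: aug)
  have "augmentation F ` fpow {..<r 0} 0 = (\<lambda>v. v 0) ` (lin_comb (r 0) (E 0) ` fpow {..<r 0} 0)"
    by (simp add: aug image_image)
  also have "\<dots> = (\<lambda>v. v 0) ` Z0"
    using gen_0 by (simp add: minimal_generators_def)
  also have "\<dots> = M"
  proof (intro equalityI subsetI)
    fix f assume "f \<in> M"
    then have "(\<lambda>l. if l = 0 then f else 0) \<in> Z0" by (simp add: Z0_def fpow_def)
    from imageI[OF this, of "\<lambda>v. v 0"] show "f \<in> (\<lambda>v. v 0) ` Z0" by simp
  qed (auto simp: Z0_def)
  finally have aug_image: "augmentation F ` fpow {..<r 0} 0 = M" .
  have exact: "lin_comb (r (Suc k)) (E (Suc k)) ` fpow {..<r (Suc k)} 0 = ?syz (r k) (E k)" for k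
    using gen_Suc[of k] by (simp add: minimal_generators_def)
  have "minimal_graded_free_resolution F M"
    unfolding minimal_graded_free_resolution_def chain_module_eq F free_scale_eq max_ideal_eq
      ideal_smult_fpow[OF finite_lessThan]
  proof (intro conjI allI impI)
    show "homogeneous (sh 0 j) (E 0 j 0)" if "j < r 0" for j
      using gen_0 that by (auto simp: minimal_generators_def vhomogeneous_def dest!: spec[of _ j])
    show "homogeneous (sh (Suc i) j - sh i l) (E (Suc i) j l)" if "j < r (Suc i)" for i j l
      using gen_Suc[of i] that by (simp add: minimal_generators_def vhomogeneous_def)
    show "augmentation F ` fpow {..<r 0} 0 = M" by (rule aug_image)
    show "differential F 1 ` fpow {..<r 1} 0 = {v \<in> fpow {..<r 0} 0. augmentation F v = 0}"
      using exact[of 0] diff[of 0] by (simp add: aug_zero)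
    show "differential F (Suc (Suc i)) ` fpow {..<r (Suc (Suc i))} 0 =
        {v \<in> fpow {..<r (Suc i)} 0. differential F (Suc i) v = 0}" for i
      using exact[of "Suc i"] by (simp add: diff)
    show "differential F (Suc i) ` fpow {..<r (Suc i)} 0 \<subseteq> fpow {..<r i} 1" for i
      using exact[of i] minimal[of i] by (simp add: diff)
  qed
  then show ?thesis by blast
qed


section \<open>Regular linear forms and Koszul sums\<close>

text \<open>Injectivity of multiplication by \<open>x\<close> on cosets, read off at the zero coset.\<close>

lemma regular_on_cosets:
  assumes N: "ring_module.subspace N" and N': "ring_module.subspace N'" and xN: "(*) x ` N \<subseteq> N'"
    and inj: "inj_on (induced_map ((*) x) N') (quotient_module A N)"
    and f: "f \<in> A" "0 \<in> A" "x * f \<in> N'"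
  shows "f \<in> N"
proof -
  have hom: "module_hom (*) (*) ((*) x)"
    by unfold_locales (simp_all add: algebra_simps)
  have map: "induced_map ((*) x) N' (v +o N) = x * v +o N'" for v
    by (rule induced_map_coset[OF hom xN ring_module.subspace_0[OF N] N'])
  have "induced_map ((*) x) N' (f +o N) = induced_map ((*) x) N' (0 +o N)"
    unfolding map coset_eq_iff[OF ring_module.module_axioms N'] using f(3) by simp
  moreover have "f +o N \<in> quotient_module A N" "0 +o N \<in> quotient_module A N"
    unfolding quotient_module_def by (rule imageI[OF f(1)], rule imageI[OF f(2)])
  ultimately have "f +o N = 0 +o N"
    by (rule inj_onD[OF inj])
  then show ?thesis
    unfolding coset_eq_iff[OF ring_module.module_axioms N] by simp
qed

lemma regular_on_quotientD:
  assumes "regular_on_quotient x T" "ring_module.subspace T" "x * f \<in> T"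
  shows "f \<in> T"
proof (rule regular_on_cosets[OF assms(2,2)])
  show "(*) x ` T \<subseteq> T"
    using ring_module.subspace_scale[OF assms(2)] by blast
  show "inj_on (induced_map ((*) x) T) (quotient_module UNIV T)"
    using assms(1) by (simp only: regular_on_quotient_def)
qed (use assms(3) in simp_all)

lemma graded_ideal_combination:
  assumes x: "homogeneous e x" and I': "graded_ideal I'" and T: "graded_ideal T"
  shows "graded_ideal ((*) x ` I' + T)"
  unfolding graded_ideal_def
proof (intro conjI allI ballI)
  have sub: "ring_module.subspace I'" "ring_module.subspace T"
    using I' T by (simp_all add: graded_ideal_def)
  show "ring_module.subspace ((*) x ` I' + T)"
  proof (rule ring_module.subspaceI)
    have "x * 0 + 0 \<in> (*) x ` I' + T"
      using sub by (intro set_plus_intro imageI ring_module.subspace_0)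
    then show "0 \<in> (*) x ` I' + T" by simp
  next
    fix f g assume "f \<in> (*) x ` I' + T" "g \<in> (*) x ` I' + T"
    then obtain a t b u where "f = x * a + t" "g = x * b + u" "a \<in> I'" "b \<in> I'" "t \<in> T" "u \<in> T"
      by (auto elim!: set_plus_elim)
    then have "f + g = x * (a + b) + (t + u)" "a + b \<in> I'" "t + u \<in> T"
      using sub by (simp_all add: algebra_simps ring_module.subspace_add)
    then show "f + g \<in> (*) x ` I' + T" by (auto intro: set_plus_intro)
  next
    fix c f assume "f \<in> (*) x ` I' + T"
    then obtain a t where "f = x * a + t" "a \<in> I'" "t \<in> T"
      by (auto elim!: set_plus_elim)
    then have "c * f = x * (c * a) + c * t" by (simp add: algebra_simps)
    moreover have "c * a \<in> I'" "c * t \<in> T"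
      using sub \<open>a \<in> I'\<close> \<open>t \<in> T\<close> by (simp_all add: ring_module.subspace_scale)
    ultimately show "c * f \<in> (*) x ` I' + T" by (auto intro: set_plus_intro)
  qed
  fix d f assume "f \<in> (*) x ` I' + T"
  then obtain a t where f: "f = x * a + t" "a \<in> I'" "t \<in> T"
    by (auto elim!: set_plus_elim)
  then have "homogeneous_component d f = x * homogeneous_component (d - e) a + homogeneous_component d t"
    using homogeneous_component_mult[OF x, of d a] by (simp add: homogeneous_component_add mult.commute)
  moreover have "homogeneous_component (d - e) a \<in> I'" "homogeneous_component d t \<in> T"
    using f I' T by (simp_all add: graded_ideal_def)
  ultimately show "homogeneous_component d f \<in> (*) x ` I' + T" by auto
qed

theorem proposition1p4:
  fixes x :: "('x::finite, 'k::field) mpoly"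
    and I' T I :: "('x, 'k) mpoly set"
  assumes "homogeneous 1 x" and "x \<noteq> 0"
    and "homogeneous_ideal I'" and "I' \<noteq> {0}"
    and "homogeneous_ideal T" and "T \<noteq> {0}"
    and "Koszul I'"
    and "T \<subseteq> ideal_smult (*) max_ideal I'"
    and "regular_on_quotient x T"
    and "regular_on_gr x T"
    and "I = (*) x ` I' + T"
  shows "Koszul I \<longleftrightarrow> Koszul T"
proof -
  have gT: "graded_ideal T" and gI': "graded_ideal I'"
    using assms(3,5) homogeneous_ideal_imp_graded by auto
  then have gI: "graded_ideal I"
    using graded_ideal_combination[OF assms(1)] assms(11) by blast
  have x: "x \<in> mpow 1" using assms(1) by (rule homogeneous_1_in_mpow)
  obtain F G where F: "minimal_graded_free_resolution F T" and G: "minimal_graded_free_resolution G I'"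
    using minimal_graded_free_resolution_exists gT gI' by blast
  let ?J = "\<lambda>i. {..<rank F i}" and ?d = "\<lambda>i. differential F (Suc i)" and ?\<epsilon> = "augmentation F"
  let ?K = "\<lambda>i. {..<rank G i}" and ?e = "\<lambda>i. differential G (Suc i)" and ?\<eta> = "augmentation G"
  note FT = minimal_graded_free_resolution_imp[OF F] and GI' = minimal_graded_free_resolution_imp[OF G]
  interpret A: minimal_resolution ?J ?d ?\<epsilon> T by (rule FT)
  interpret B: minimal_resolution ?K ?e ?\<eta> I' by (rule GI')
  have acB: "B.linear_part_acyclic"
    using Koszul_iff_acyclic[OF _ GI'] G assms(7) by blast
  obtain \<phi> where \<phi>: "\<And>i. linear_map (\<phi> i)"
      "\<And>i v. v \<in> fpow (?J i) 0 \<Longrightarrow> \<phi> i v \<in> fpow (?K i) 1"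
      "\<And>v. v \<in> fpow (?J 0) 0 \<Longrightarrow> ?\<eta> (\<phi> 0 v) = ?\<epsilon> v"
      "\<And>i v. v \<in> fpow (?J (Suc i)) 0 \<Longrightarrow> ?e i (\<phi> (Suc i) v) = \<phi> i (?d i v)"
    using minimal_chain_map_exists[OF FT GI' assms(8)[unfolded max_ideal_eq] acB] by metis
  have subT: "ring_module.subspace T" using gT by (simp add: graded_ideal_def)
  interpret C: sum_cone ?J ?d ?\<epsilon> T ?K ?e ?\<eta> I' x \<phi>
  proof (rule sum_cone.intro[OF FT GI'], rule sum_cone_axioms.intro)
    show "x \<in> mpow 1" by (rule x)
    show "linear_map (\<phi> i)" for i by (rule \<phi>(1))
    show "\<phi> i v \<in> fpow (?K i) 1" if "v \<in> fpow (?J i) 0" for i v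
      using that by (rule \<phi>(2))
    show "?\<eta> (\<phi> 0 v) = ?\<epsilon> v" if "v \<in> fpow (?J 0) 0" for v
      using that by (rule \<phi>(3))
    show "?e i (\<phi> (Suc i) v) = \<phi> i (?d i v)" if "v \<in> fpow (?J (Suc i)) 0" for i v
      using that by (rule \<phi>(4))
    show "f \<in> T" if "x * f \<in> T" for f
      using that by (rule regular_on_quotientD[OF assms(9) subT])
  qed
  have sub: "ring_module.subspace (?\<epsilon> ` fpow (?J 0) t)" for t
    by (rule module_hom.subspace_image[OF A.linear_aug subspace_fpow])
  have gr: "f \<in> ?\<epsilon> ` fpow (?J 0) (s + 1)"
    if "f \<in> ?\<epsilon> ` fpow (?J 0) s" "x * f \<in> ?\<epsilon> ` fpow (?J 0) (s + 2)" for s f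
  proof (rule regular_on_cosets[OF sub sub])
    show "0 \<in> ?\<epsilon> ` fpow (?J 0) s"
      by (rule ring_module.subspace_0[OF sub])
    show "(*) x ` ?\<epsilon> ` fpow (?J 0) (s + 1) \<subseteq> ?\<epsilon> ` fpow (?J 0) (s + 2)"
      using C.x_fpow[of _ "?J 0" "s + 1"] by (auto simp flip: A.aug_simps(3))
    show "inj_on (induced_map ((*) x) (?\<epsilon> ` fpow (?J 0) (s + 2)))
        (quotient_module (?\<epsilon> ` fpow (?J 0) s) (?\<epsilon> ` fpow (?J 0) (s + 1)))"
      using assms(10) by (simp only: regular_on_gr_def max_ideal_power_eq A.aug_image_fpow)
  qed (rule that)+
  have "Koszul I \<longleftrightarrow> C.cone.linear_part_acyclic"
    unfolding assms(11)
    by (rule Koszul_iff_acyclic[OF minimal_graded_free_resolution_exists C.cone.minimal_resolution_axioms])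
      (use gI assms(11) in simp)
  also have "\<dots> \<longleftrightarrow> A.linear_part_acyclic"
    using C.cone_acyclic_imp_acyclic C.acyclic_imp_cone_acyclic[OF _ acB gr] by blast
  also have "\<dots> \<longleftrightarrow> Koszul T"
    by (rule Koszul_iff_acyclic[OF minimal_graded_free_resolution_exists[OF gT] FT, symmetric])
  finally show ?thesis .
qed

end
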